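(* Let $g\ge 0$ and $n\ge 1$, and fix a basepoint $[x_1,\dots,x_n]\in C_n(\Sigma_g)$ and a point $(x_1,\dots,x_n)\in F_n(\Sigma_g)$ above it. The function $\omega:B_n(\Sigma_g)\to H_1(\Sigma_g;\mathbb{Z})$, $[\phi]\mapsto\left[\sum_{i=1}^n (p_i\circ\tilde\phi)\right]$, where $\tilde\phi$ is the unique lift of the loop $\phi$ to $F_n(\Sigma_g)$ with $\tilde\phi(0)=(x_1,\dots,x_n)$, is a well-defined group homomorphism.
   Context: $\Sigma_g$ is the closed orientable surface of genus $g$. $F_n(\Sigma_g)=\{(y_1,\dots,y_n)\in\Sigma_g^n : y_i\ne y_j \text{ for } i\neq j\}$, $C_n(\Sigma_g)=F_n(\Sigma_g)/S_n$ (the symmetric group permuting coordinates), the quotient map $\pi:F_n(\Sigma_g)\to C_n(\Sigma_g)$ is a covering map, $p_i:F_n(\Sigma_g)\to\Sigma_g$ is the $i$-th coordinate projection, and $B_n(\Sigma_g)=\pi_1(C_n(\Sigma_g),[x_1,\dots,x_n])$. Each path $p_i\circ\tilde\phi:[0,1]\to\Sigma_g$ is viewed as a singular $1$-simplex; the sum $\sum_i p_i\circ\tilde\phi$ is a singular $1$-cycle, and $[\cdot]$ denotes its integral homology class. *)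

theory Defs
  imports "HOL-Homology.Homology" "HOL-Combinatorics.Permutations"
begin

section \<open>Closed orientable surfaces\<close>

definition closed_surface :: "'a topology \<Rightarrow> bool" where
  "closed_surface X \<longleftrightarrow>
     topspace X \<noteq> {} \<and> compact_space X \<and> connected_space X \<and> Hausdorff_space X \<and>
     (\<forall>x\<in>topspace X. \<exists>U. openin X U \<and> x \<in> U \<and>
        subtopology X U homeomorphic_space Euclidean_space 2)"

text \<open>A \<open>\<int>\<close>-orientation of a surface: a choice of generators of the local homology groups
  \<open>H\<^sub>2(X, X - {x})\<close> that is locally induced by a single class of \<open>H\<^sub>2(X, X - U)\<close>.\<close>

definition surface_orientation :: "'a topology \<Rightarrow> ('a \<Rightarrow> 'a chain set) \<Rightarrow> bool" where
  "surface_orientation X \<mu> \<longleftrightarrow>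
     (\<forall>x\<in>topspace X.
        \<mu> x \<in> carrier (relative_homology_group 2 X (topspace X - {x})) \<and>
        generate (relative_homology_group 2 X (topspace X - {x})) {\<mu> x}
          = carrier (relative_homology_group 2 X (topspace X - {x}))) \<and>
     (\<forall>x\<in>topspace X. \<exists>U \<alpha>. openin X U \<and> x \<in> U \<and>
        \<alpha> \<in> carrier (relative_homology_group 2 X (topspace X - U)) \<and>
        (\<forall>y\<in>U. hom_induced 2 X (topspace X - U) X (topspace X - {y}) id \<alpha> = \<mu> y))"

definition orientable_surface :: "'a topology \<Rightarrow> bool" where
  "orientable_surface X \<longleftrightarrow> (\<exists>\<mu>. surface_orientation X \<mu>)"

text \<open>The genus is the largest number of pairwise disjoint simple closed curves whose union does
  not separate the surface.\<close>

definition simple_closed_curve :: "'a topology \<Rightarrow> 'a set \<Rightarrow> bool" where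
  "simple_closed_curve X C \<longleftrightarrow>
     C \<subseteq> topspace X \<and> subtopology X C homeomorphic_space top_of_set (sphere (0::complex) 1)"

definition nonseparating_curves :: "'a topology \<Rightarrow> 'a set set \<Rightarrow> bool" where
  "nonseparating_curves X \<C> \<longleftrightarrow>
     finite \<C> \<and> pairwise disjnt \<C> \<and> (\<forall>C\<in>\<C>. simple_closed_curve X C) \<and>
     connectedin X (topspace X - \<Union>\<C>)"

definition has_genus :: "'a topology \<Rightarrow> nat \<Rightarrow> bool" where
  "has_genus X g \<longleftrightarrow>
     (\<exists>\<C>. nonseparating_curves X \<C> \<and> card \<C> = g) \<and>
     (\<forall>\<C>. nonseparating_curves X \<C> \<longrightarrow> card \<C> \<le> g)"

definition closed_orientable_surface :: "nat \<Rightarrow> 'a topology \<Rightarrow> bool" where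
  "closed_orientable_surface g X \<longleftrightarrow>
     closed_surface X \<and> orientable_surface X \<and> has_genus X g"


section \<open>Configuration spaces\<close>

definition ordered_config :: "nat \<Rightarrow> 'a topology \<Rightarrow> (nat \<Rightarrow> 'a) topology" where
  "ordered_config n X =
     subtopology (product_topology (\<lambda>i. X) {1..n}) {y. inj_on y {1..n}}"

definition config_class :: "nat \<Rightarrow> (nat \<Rightarrow> 'a) \<Rightarrow> (nat \<Rightarrow> 'a) set" where
  "config_class n y = {y \<circ> \<sigma> |\<sigma>. \<sigma> permutes {1..n}}"

definition quotient_topology :: "'a topology \<Rightarrow> ('a \<Rightarrow> 'b) \<Rightarrow> 'b topology" where
  "quotient_topology X f =
     topology (\<lambda>U. U \<subseteq> f ` topspace X \<and> openin X {x \<in> topspace X. f x \<in> U})"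

lemma openin_quotient_topology:
  "openin (quotient_topology X f) U \<longleftrightarrow>
     U \<subseteq> f ` topspace X \<and> openin X {x \<in> topspace X. f x \<in> U}"
proof -
  have "istopology (\<lambda>U. U \<subseteq> f ` topspace X \<and> openin X {x \<in> topspace X. f x \<in> U})"
    unfolding istopology_def
  proof (intro conjI allI impI)
    fix S T
    assume "S \<subseteq> f ` topspace X \<and> openin X {x \<in> topspace X. f x \<in> S}"
      and "T \<subseteq> f ` topspace X \<and> openin X {x \<in> topspace X. f x \<in> T}"
    moreover have "{x \<in> topspace X. f x \<in> S \<inter> T}
        = {x \<in> topspace X. f x \<in> S} \<inter> {x \<in> topspace X. f x \<in> T}"
      by auto
    ultimately show "S \<inter> T \<subseteq> f ` topspace X" "openin X {x \<in> topspace X. f x \<in> S \<inter> T}"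
      by (auto intro: openin_Int)
  next
    fix \<K>
    assume *: "\<forall>K\<in>\<K>. K \<subseteq> f ` topspace X \<and> openin X {x \<in> topspace X. f x \<in> K}"
    then show "\<Union>\<K> \<subseteq> f ` topspace X" by blast
    have "{x \<in> topspace X. f x \<in> \<Union>\<K>} = (\<Union>K\<in>\<K>. {x \<in> topspace X. f x \<in> K})"
      by auto
    with * show "openin X {x \<in> topspace X. f x \<in> \<Union>\<K>}" by auto
  qed
  then show ?thesis
    by (simp add: quotient_topology_def)
qed

lemma topspace_quotient_topology: "topspace (quotient_topology X f) = f ` topspace X"
proof -
  have "{x \<in> topspace X. f x \<in> f ` topspace X} = topspace X" by auto
  then have "openin (quotient_topology X f) (f ` topspace X)"
    by (simp add: openin_quotient_topology)
  moreover have "topspace (quotient_topology X f) \<subseteq> f ` topspace X"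
    using openin_topspace [of "quotient_topology X f"] by (simp only: openin_quotient_topology)
  ultimately show ?thesis
    by (simp add: openin_subset subset_antisym)
qed

lemma quotient_map_quotient_topology: "quotient_map X (quotient_topology X f) f"
  by (auto simp: quotient_map_def topspace_quotient_topology openin_quotient_topology)

definition unordered_config :: "nat \<Rightarrow> 'a topology \<Rightarrow> (nat \<Rightarrow> 'a) set topology" where
  "unordered_config n X = quotient_topology (ordered_config n X) (config_class n)"


section \<open>Fundamental groups\<close>

text \<open>As for \<^const>\<open>pathin\<close>, paths are total functions whose values outside the unit interval are
  irrelevant; loops that agree on the unit interval are homotopic in the sense below.\<close>

definition loops_at :: "'a topology \<Rightarrow> 'a \<Rightarrow> (real \<Rightarrow> 'a) set" where
  "loops_at X b = {p. pathin X p \<and> p 0 = b \<and> p 1 = b}"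

definition loop_class :: "'a topology \<Rightarrow> 'a \<Rightarrow> (real \<Rightarrow> 'a) \<Rightarrow> (real \<Rightarrow> 'a) set" where
  "loop_class X b p =
     {q. homotopic_with (\<lambda>r. r 0 = b \<and> r 1 = b) (top_of_set {0..1}) X p q}"

definition path_concat :: "(real \<Rightarrow> 'a) \<Rightarrow> (real \<Rightarrow> 'a) \<Rightarrow> real \<Rightarrow> 'a" where
  "path_concat p q = (\<lambda>t. if t \<le> 1/2 then p (2 * t) else q (2 * t - 1))"

definition fundamental_group :: "'a topology \<Rightarrow> 'a \<Rightarrow> (real \<Rightarrow> 'a) set monoid" where
  "fundamental_group X b =
     \<lparr>carrier = loop_class X b ` loops_at X b,
      monoid.mult = (\<lambda>A B. \<Union>p\<in>A. \<Union>q\<in>B. loop_class X b (path_concat p q)),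
      one = loop_class X b (\<lambda>t. b)\<rparr>"

definition surface_braid_group ::
    "nat \<Rightarrow> 'a topology \<Rightarrow> (nat \<Rightarrow> 'a) \<Rightarrow> (real \<Rightarrow> (nat \<Rightarrow> 'a) set) set monoid" where
  "surface_braid_group n X x = fundamental_group (unordered_config n X) (config_class n x)"


section \<open>The map from the braid group to first homology\<close>

definition is_config_lift ::
    "nat \<Rightarrow> 'a topology \<Rightarrow> (nat \<Rightarrow> 'a) \<Rightarrow> (real \<Rightarrow> (nat \<Rightarrow> 'a) set) \<Rightarrow> (real \<Rightarrow> nat \<Rightarrow> 'a) \<Rightarrow> bool" where
  "is_config_lift n X x \<phi> \<psi> \<longleftrightarrow>
     pathin (ordered_config n X) \<psi> \<and> \<psi> 0 = x \<and> (\<forall>t\<in>{0..1}. config_class n (\<psi> t) = \<phi> t)"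

text \<open>Restricting to \<^term>\<open>extensional {0..1}\<close> makes the lift unique as a total function.\<close>

definition config_lift ::
    "nat \<Rightarrow> 'a topology \<Rightarrow> (nat \<Rightarrow> 'a) \<Rightarrow> (real \<Rightarrow> (nat \<Rightarrow> 'a) set) \<Rightarrow> real \<Rightarrow> nat \<Rightarrow> 'a" where
  "config_lift n X x \<phi> = (THE \<psi>. \<psi> \<in> extensional {0..1} \<and> is_config_lift n X x \<phi> \<psi>)"

text \<open>The standard 1-simplex is identified with the unit interval by its coordinate of index 1, so
  that the boundary of the simplex of a path \<open>p\<close> is \<open>p 1 - p 0\<close>.\<close>

definition path_simplex :: "(real \<Rightarrow> 'a) \<Rightarrow> (nat \<Rightarrow> real) \<Rightarrow> 'a" where
  "path_simplex p = restrict (\<lambda>v. p (v 1)) (standard_simplex 1)"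

definition lift_chain ::
    "nat \<Rightarrow> 'a topology \<Rightarrow> (nat \<Rightarrow> 'a) \<Rightarrow> (real \<Rightarrow> (nat \<Rightarrow> 'a) set) \<Rightarrow> 'a chain" where
  "lift_chain n X x \<phi> = (\<Sum>i=1..n. frag_of (path_simplex (\<lambda>t. config_lift n X x \<phi> t i)))"

text \<open>The common value of the homology class over all representatives of a homotopy class; it is
  meaningful only if that value does not depend on the representative.\<close>

definition braid_homology ::
    "nat \<Rightarrow> 'a topology \<Rightarrow> (nat \<Rightarrow> 'a) \<Rightarrow> (real \<Rightarrow> (nat \<Rightarrow> 'a) set) set \<Rightarrow> 'a chain set" where
  "braid_homology n X x c =
     the_elem ((\<lambda>\<phi>. homologous_rel_set 1 X {} (lift_chain n X x \<phi>)) ` c)"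

end

theory Submission
  imports Defs
begin

text \<open>The quotient map from ordered to unordered configurations of a Hausdorff space is a covering, so
  loops and their homotopies lift uniquely. A lifted homotopy is constant on the two vertical sides
  of the square, hence its coordinates are homotopies of paths in the surface with fixed endpoints,
  and homotopic paths are homologous. The lift of a product of loops is the concatenation of the
  first lift with the second one precomposed with the permutation read off at the end of the first;
  since a concatenation is homologous to the sum of its parts and the chain is a sum over all
  coordinates, the permutation is invisible in homology.\<close>


section \<open>Covering maps and lifting\<close>

text \<open>A single coordinate of a lifted loop need not be closed, because the lift may end at a
  permutation of \<open>x\<close>; by itself it has no homology class. The argument therefore works
  with chains rather than cycles: \<open>homologous_rel 1 X {}\<close> only asks that a difference
  be a boundary, so homotopies and concatenations are treated one coordinate at a time and then
  summed. Only the total is a cycle. The covering property comes from separating points: once the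
  points of a configuration have disjoint neighbourhoods, a nearby ordered configuration is fixed by
  its unordered class together with the assignment of indices to neighbourhoods. These assignments,
  one for each permutation, label the sheets.\<close>

definition covering_map :: "'e topology \<Rightarrow> 'b topology \<Rightarrow> ('e \<Rightarrow> 'b) \<Rightarrow> bool" where
  "covering_map E B p \<longleftrightarrow>
     continuous_map E B p \<and>
     (\<forall>b\<in>topspace B. \<exists>T \<V>. openin B T \<and> b \<in> T \<and> \<Union>\<V> = {e \<in> topspace E. p e \<in> T} \<and>
        pairwise disjnt \<V> \<and>
        (\<forall>V\<in>\<V>. openin E V \<and> homeomorphic_map (subtopology E V) (subtopology B T) p))"

text \<open>Agreement of two lifts is locally constant. Near \<open>w\<close> the values of
  \<open>f\<close> stay in one sheet and those of \<open>g\<close> in one sheet; they agree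
  throughout if the sheets coincide, since \<open>p\<close> is injective on a sheet, and nowhere
  otherwise, since distinct sheets are disjoint. Connectedness then spreads the agreement from
  \<open>z0\<close>.\<close>

lemma covering_map_unique_lift:
  assumes p: "covering_map E B p" and Z: "connected_space Z"
    and f: "continuous_map Z E f" and g: "continuous_map Z E g"
    and eq: "\<And>z. z \<in> topspace Z \<Longrightarrow> p (f z) = p (g z)"
    and z0: "z0 \<in> topspace Z" "f z0 = g z0" and z: "z \<in> topspace Z"
  shows "f z = g z"
proof -
  have nbhd: "\<exists>N. openin Z N \<and> w \<in> N \<and> (\<forall>v\<in>N. f v = g v \<longleftrightarrow> f w = g w)"
    if w: "w \<in> topspace Z" for w
  proof -
    have fw: "f w \<in> topspace E" and gw: "g w \<in> topspace E"
      using f g w by (auto simp: continuous_map_def)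
    then have "p (f w) \<in> topspace B"
      using p by (auto simp: covering_map_def continuous_map_def)
    then obtain T \<V> where T: "openin B T" "p (f w) \<in> T" "\<Union>\<V> = {e \<in> topspace E. p e \<in> T}"
        "pairwise disjnt \<V>"
        "\<And>V. V \<in> \<V> \<Longrightarrow> openin E V \<and> homeomorphic_map (subtopology E V) (subtopology B T) p"
      using p unfolding covering_map_def by meson
    obtain V1 where V1: "V1 \<in> \<V>" "f w \<in> V1"
      using T fw by blast
    have "p (g w) \<in> T" using T eq w by auto
    then obtain V2 where V2: "V2 \<in> \<V>" "g w \<in> V2"
      using T gw by blast
    define N where "N = {v \<in> topspace Z. f v \<in> V1} \<inter> {v \<in> topspace Z. g v \<in> V2}"
    have "openin Z N"
      unfolding N_def using f g T V1 V2 by (intro openin_Int openin_continuous_map_preimage) auto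
    moreover have "w \<in> N" using w V1 V2 by (auto simp: N_def)
    moreover have "f v = g v \<longleftrightarrow> V1 = V2" if v: "v \<in> N" for v
    proof
      assume "f v = g v"
      then show "V1 = V2"
        using T(4) V1 V2 v by (auto simp: N_def pairwise_def disjnt_iff)
    next
      assume "V1 = V2"
      moreover have "inj_on p (topspace E \<inter> V1)"
        using T(5) [OF V1(1)] by (simp add: homeomorphic_eq_everything_map)
      moreover have "f v \<in> topspace E" "g v \<in> topspace E"
        using f g v by (auto simp: continuous_map_def N_def)
      ultimately show "f v = g v"
        using eq v by (auto simp: N_def inj_on_def)
    qed
    ultimately show ?thesis by metis
  qed
  \<comment> \<open>The Boolean \<open>b\<close> treats the agreement set and its complement in one
    argument.\<close>
  have clopen: "openin Z {w \<in> topspace Z. (f w = g w) = b}" for b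
  proof (subst openin_subopen, clarify)
    fix w assume "w \<in> topspace Z"
    then obtain N where "openin Z N" "w \<in> N" "\<forall>v\<in>N. f v = g v \<longleftrightarrow> f w = g w"
      using nbhd by blast
    then show "\<exists>N. openin Z N \<and> w \<in> N \<and> N \<subseteq> {v \<in> topspace Z. (f v = g v) = (f w = g w)}"
      using openin_subset [of Z N] by (intro exI [of _ N]) blast
  qed
  have "openin Z {w \<in> topspace Z. f w = g w}" "openin Z {w \<in> topspace Z. f w \<noteq> g w}"
    using clopen [of True] clopen [of False] by simp_all
  moreover have "topspace Z - {w \<in> topspace Z. f w = g w} = {w \<in> topspace Z. f w \<noteq> g w}"
    by auto
  ultimately have "openin Z {w \<in> topspace Z. f w = g w}" "closedin Z {w \<in> topspace Z. f w = g w}"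
    by (simp_all add: closedin_def)
  then have "{w \<in> topspace Z. f w = g w} = {} \<or> {w \<in> topspace Z. f w = g w} = topspace Z"
    using Z connected_space_clopen_in by blast
  then show ?thesis using z z0 by blast
qed

text \<open>The value of the lift may be prescribed at any point of \<open>S\<close>, not only at a
  base point. This is what allows a lift on one piece to be continued into an adjacent piece from
  wherever the two meet.\<close>

definition liftable ::
    "'e topology \<Rightarrow> ('e \<Rightarrow> 'b) \<Rightarrow> 'z::topological_space set \<Rightarrow> ('z \<Rightarrow> 'b) \<Rightarrow> bool" where
  "liftable E p S h \<longleftrightarrow>
     (\<forall>z\<in>S. \<forall>e\<in>topspace E. p e = h z \<longrightarrow>
        (\<exists>k. continuous_map (top_of_set S) E k \<and> k z = e \<and> (\<forall>w\<in>S. p (k w) = h w)))"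

text \<open>Lift on the piece containing the prescribed point, then on the other piece starting from
  the value reached at a common point \<open>m\<close>. By uniqueness the two lifts agree on the
  whole connected overlap, so they paste along the closed pieces.\<close>

lemma liftable_Un:
  assumes p: "covering_map E B p" and S: "closed S" and T: "closed T"
    and ST: "connected (S \<inter> T)" "S \<inter> T \<noteq> {}"
    and hS: "liftable E p S h" and hT: "liftable E p T h"
  shows "liftable E p (S \<union> T) h"
proof -
  obtain m where m: "m \<in> S" "m \<in> T" using ST by auto
  have glue: "\<exists>k. continuous_map (top_of_set (S \<union> T)) E k \<and> (\<forall>w\<in>S \<union> T. p (k w) = h w) \<and>
                  (\<forall>w\<in>S. k w = f w) \<and> (\<forall>w\<in>T. k w = g w)"
    if f: "continuous_map (top_of_set S) E f" "\<And>w. w \<in> S \<Longrightarrow> p (f w) = h w"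
      and g: "continuous_map (top_of_set T) E g" "\<And>w. w \<in> T \<Longrightarrow> p (g w) = h w"
      and fg: "f m = g m" for f g
  proof -
    have agree: "f w = g w" if "w \<in> S \<inter> T" for w
    proof (rule covering_map_unique_lift [OF p, where Z = "top_of_set (S \<inter> T)" and f = f and g = g and ?z0.0 = m])
      show "connected_space (top_of_set (S \<inter> T))"
        using ST(1) connectedin_def connectedin_iff_connected by blast
      show "continuous_map (top_of_set (S \<inter> T)) E f" "continuous_map (top_of_set (S \<inter> T)) E g"
        using continuous_map_from_subtopology_mono [OF f(1)] continuous_map_from_subtopology_mono [OF g(1)]
        by auto
    qed (use f g fg m that in auto)
    let ?k = "\<lambda>w. if w \<in> S then f w else g w"
    have "continuous_map (top_of_set (S \<union> T)) E ?k"
    proof (rule pasting_lemma_closed [where I = UNIV and T = "\<lambda>b. if b then S else T"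
          and f = "\<lambda>b. if b then f else g"])
      show "closedin (top_of_set (S \<union> T)) (if b then S else T)" for b
        using S T by (simp add: closed_subset)
      show "continuous_map (subtopology (top_of_set (S \<union> T)) (if b then S else T)) E (if b then f else g)" for b
        using f(1) g(1) by (simp add: subtopology_subtopology Int_absorb1)
    qed (use agree in \<open>auto split: if_splits\<close>)
    then show ?thesis using agree f g by (intro exI [of _ ?k]) auto
  qed
  show ?thesis
    unfolding liftable_def
  proof (intro ballI impI)
    fix z e assume z: "z \<in> S \<union> T" and e: "e \<in> topspace E" "p e = h z"
    from z consider "z \<in> S" | "z \<in> T" by auto
    then show "\<exists>k. continuous_map (top_of_set (S \<union> T)) E k \<and> k z = e \<and> (\<forall>w\<in>S \<union> T. p (k w) = h w)"
    proof cases
      case 1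
      then obtain f where f: "continuous_map (top_of_set S) E f" "f z = e" "\<forall>w\<in>S. p (f w) = h w"
        using hS e unfolding liftable_def by blast
      then have "f m \<in> topspace E" "p (f m) = h m"
        using m by (auto simp: continuous_map_def)
      then obtain g where "continuous_map (top_of_set T) E g" "g m = f m" "\<forall>w\<in>T. p (g w) = h w"
        using hT m unfolding liftable_def by blast
      with f 1 glue [of f g] show ?thesis by metis
    next
      case 2
      then obtain g where g: "continuous_map (top_of_set T) E g" "g z = e" "\<forall>w\<in>T. p (g w) = h w"
        using hT e unfolding liftable_def by blast
      then have "g m \<in> topspace E" "p (g m) = h m"
        using m by (auto simp: continuous_map_def)
      then obtain f where "continuous_map (top_of_set S) E f" "f m = g m" "\<forall>w\<in>S. p (f w) = h w"
        using hS m unfolding liftable_def by blast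
      with g 2 glue [of f g] show ?thesis by metis
    qed
  qed
qed

text \<open>Over an evenly covered set a lift is \<open>h\<close> followed by the inverse of
  \<open>p\<close> on a sheet. The sheet depends on the prescribed value \<open>e\<close>, but
  \<open>U\<close> does not, so one \<open>U\<close> serves every \<open>R\<close> and every
  starting value.\<close>

lemma liftable_locally:
  assumes p: "covering_map E B p" and h: "continuous_map (top_of_set S) B h" and z: "z \<in> S"
  shows "\<exists>U. open U \<and> z \<in> U \<and> (\<forall>R. R \<subseteq> S \<inter> U \<longrightarrow> liftable E p R h)"
proof -
  have "h z \<in> topspace B" using h z by (auto simp: continuous_map_def)
  then obtain T \<V> where T: "openin B T" "h z \<in> T" "\<Union>\<V> = {e \<in> topspace E. p e \<in> T}"
      "\<And>V. V \<in> \<V> \<Longrightarrow> openin E V \<and> homeomorphic_map (subtopology E V) (subtopology B T) p"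
    using p unfolding covering_map_def by meson
  have "openin (top_of_set S) {w \<in> S. h w \<in> T}"
    using openin_continuous_map_preimage [OF h T(1)] by simp
  then obtain U where U: "open U" "{w \<in> S. h w \<in> T} = S \<inter> U"
    by (auto simp: openin_open)
  have "liftable E p R h" if R: "R \<subseteq> S \<inter> U" for R
    unfolding liftable_def
  proof (intro ballI impI)
    fix w e assume w: "w \<in> R" and e: "e \<in> topspace E" "p e = h w"
    have hT: "h ` R \<subseteq> T" using R U by blast
    then obtain V where V: "V \<in> \<V>" "e \<in> V" using T e w by blast
    then obtain q where q: "homeomorphic_maps (subtopology E V) (subtopology B T) p q"
      using T(4) homeomorphic_map_maps by blast
    have cont: "continuous_map (top_of_set R) (subtopology B T) h"
      using h R hT by (auto simp: continuous_map_in_subtopology intro: continuous_map_from_subtopology_mono)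
    have "continuous_map (top_of_set R) E (q \<circ> h)"
      using q continuous_map_compose [OF cont]
      by (metis homeomorphic_maps_def continuous_map_in_subtopology)
    moreover have "(q \<circ> h) w = e"
    proof -
      have "e \<in> topspace (subtopology E V)" using e V by simp
      then have "q (p e) = e" using q unfolding homeomorphic_maps_def by blast
      then show ?thesis by (simp add: e(2))
    qed
    moreover have "p ((q \<circ> h) v) = h v" if "v \<in> R" for v
    proof -
      have "h v \<in> topspace (subtopology B T)" 
        using cont that by (auto simp: continuous_map_def)
      then show ?thesis using q by (simp add: homeomorphic_maps_def)
    qed
    ultimately show "\<exists>k. continuous_map (top_of_set R) E k \<and> k w = e \<and> (\<forall>w\<in>R. p (k w) = h w)"
      by blast
  qed
  then show ?thesis using U T z by blast
qed

text \<open>Bisecting first the second and then the first coordinate avoids a Lebesgue number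
  argument.\<close>

lemma liftable_rectangle:
  fixes h :: "real \<times> real \<Rightarrow> 'b"
  assumes p: "covering_map E B p" and h: "continuous_map (top_of_set ({a..b} \<times> {c..d})) B h"
    and "a \<le> b" "c \<le> d"
  shows "liftable E p ({a..b} \<times> {c..d}) h"
proof -
  \<comment> \<open>Around each vertical line there is a strip of positive width that lifts over the
    full height. Its width is the minimum of the widths met while bisecting the height.\<close>
  have slab: "\<exists>\<delta>>0. \<forall>u v. a \<le> u \<and> u \<le> s \<and> s \<le> v \<and> v \<le> b \<and> v - u < \<delta> \<longrightarrow>
                 liftable E p ({u..v} \<times> {c..d}) h" if s: "a \<le> s" "s \<le> b" for s
  proof -
    \<comment> \<open>The bounds sit inside \<open>P\<close> as a premise because
      \<open>Bolzano\<close> tests every short interval around a point, including those that stick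
      out of \<open>{c..d}\<close>; \<open>Q\<close> below has the same shape.\<close>
    define P where "P c' d' \<longleftrightarrow> c \<le> c' \<and> d' \<le> d \<longrightarrow>
        (\<exists>\<delta>>0. \<forall>u v. a \<le> u \<and> u \<le> s \<and> s \<le> v \<and> v \<le> b \<and> v - u < \<delta> \<longrightarrow>
                 liftable E p ({u..v} \<times> {c'..d'}) h)" for c' d'
    have "P c d"
      using \<open>c \<le> d\<close>
    proof (rule Bolzano [of _ _ P])
      fix i j k assume trans: "P i j" "P j k" "i \<le> j" "j \<le> k"
      show "P i k"
        unfolding P_def
      proof
        assume "c \<le> i \<and> k \<le> d"
        then have "c \<le> i \<and> j \<le> d" "c \<le> j \<and> k \<le> d" using trans by auto
        then obtain \<delta>1 \<delta>2 where \<delta>: "\<delta>1 > 0" "\<delta>2 > 0"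
          and 1: "\<And>u v. a \<le> u \<and> u \<le> s \<and> s \<le> v \<and> v \<le> b \<and> v - u < \<delta>1 \<Longrightarrow>
                 liftable E p ({u..v} \<times> {i..j}) h"
          and 2: "\<And>u v. a \<le> u \<and> u \<le> s \<and> s \<le> v \<and> v \<le> b \<and> v - u < \<delta>2 \<Longrightarrow>
                 liftable E p ({u..v} \<times> {j..k}) h"
          using trans(1,2) unfolding P_def by blast
        have "liftable E p ({u..v} \<times> {i..k}) h"
          if uv: "a \<le> u \<and> u \<le> s \<and> s \<le> v \<and> v \<le> b \<and> v - u < min \<delta>1 \<delta>2" for u v
        proof -
          have "{u..v} \<times> {i..k} = {u..v} \<times> {i..j} \<union> {u..v} \<times> {j..k}"
            using trans by auto
          moreover have "{u..v} \<times> {i..j} \<inter> {u..v} \<times> {j..k} = {u..v} \<times> {j}"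
            using trans by auto
          moreover have "connected ({u..v} \<times> {j})" "{u..v} \<times> {j} \<noteq> {}"
            using uv by (auto intro!: connected_Times)
          ultimately show ?thesis
            using liftable_Un [OF p, of "{u..v} \<times> {i..j}" "{u..v} \<times> {j..k}" h] uv 1 [of u v] 2 [of u v]
            by (simp add: closed_Times)
        qed
        with \<delta> show "\<exists>\<delta>>0. \<forall>u v. a \<le> u \<and> u \<le> s \<and> s \<le> v \<and> v \<le> b \<and> v - u < \<delta> \<longrightarrow>
                 liftable E p ({u..v} \<times> {i..k}) h"
          by (intro exI [of _ "min \<delta>1 \<delta>2"]) auto
      qed
    next
      fix t assume "c \<le> t" "t \<le> d"
      then obtain U where U: "open U" "(s, t) \<in> U"
          "\<And>R. R \<subseteq> {a..b} \<times> {c..d} \<inter> U \<Longrightarrow> liftable E p R h"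
        using liftable_locally [OF p h, of "(s,t)"] s by auto
      obtain A B where AB: "open A" "open B" "s \<in> A" "t \<in> B" "A \<times> B \<subseteq> U"
        using U open_prod_elim by (metis mem_Sigma_iff)
      obtain \<delta> where \<delta>: "\<delta> > 0" "ball s \<delta> \<subseteq> A" using AB open_contains_ball by blast
      obtain \<epsilon> where \<epsilon>: "\<epsilon> > 0" "ball t \<epsilon> \<subseteq> B" using AB open_contains_ball by blast
      have "liftable E p ({u..v} \<times> {i..j}) h"
        if "i \<le> t \<and> t \<le> j \<and> j - i < \<epsilon>" "c \<le> i \<and> j \<le> d"
          "a \<le> u \<and> u \<le> s \<and> s \<le> v \<and> v \<le> b \<and> v - u < \<delta>" for u v i j
      proof (rule U(3))
        have "{u..v} \<subseteq> ball s \<delta>" "{i..j} \<subseteq> ball t \<epsilon>"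
          using that by (auto simp: dist_real_def)
        then show "{u..v} \<times> {i..j} \<subseteq> {a..b} \<times> {c..d} \<inter> U"
          using \<delta>(2) \<epsilon>(2) AB(5) that(2,3) by (intro Int_greatest Sigma_mono order_trans [OF _ AB(5)]) auto
      qed
      then show "\<exists>\<epsilon>>0. \<forall>i j. i \<le> t \<and> t \<le> j \<and> j - i < \<epsilon> \<longrightarrow> P i j"
        unfolding P_def using \<delta>(1) \<epsilon>(1) by (intro exI [of _ \<epsilon>]) blast
    qed
    then show ?thesis by (simp add: P_def)
  qed
  define Q where "Q a' b' \<longleftrightarrow> a \<le> a' \<and> b' \<le> b \<longrightarrow> liftable E p ({a'..b'} \<times> {c..d}) h" for a' b'
  have "Q a b"
    using \<open>a \<le> b\<close>
  proof (rule Bolzano [of _ _ Q])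
    fix i j k assume trans: "Q i j" "Q j k" "i \<le> j" "j \<le> k"
    have "{i..k} \<times> {c..d} = {i..j} \<times> {c..d} \<union> {j..k} \<times> {c..d}"
      using trans by auto
    moreover have "{i..j} \<times> {c..d} \<inter> {j..k} \<times> {c..d} = {j} \<times> {c..d}"
      using trans by auto
    moreover have "connected ({j} \<times> {c..d})" "{j} \<times> {c..d} \<noteq> {}"
      using \<open>c \<le> d\<close> by (auto intro!: connected_Times)
    ultimately show "Q i k"
      using liftable_Un [OF p, of "{i..j} \<times> {c..d}" "{j..k} \<times> {c..d}" h] trans
      unfolding Q_def by (simp add: closed_Times)
  next
    fix s assume "a \<le> s" "s \<le> b"
    then show "\<exists>\<delta>>0. \<forall>i j. i \<le> s \<and> s \<le> j \<and> j - i < \<delta> \<longrightarrow> Q i j"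
      unfolding Q_def using slab [of s] by blast
  qed
  then show ?thesis by (simp add: Q_def)
qed

lemma covering_map_homotopy_lifting:
  fixes h :: "real \<times> real \<Rightarrow> 'b"
  assumes "covering_map E B p" "continuous_map (top_of_set ({0..1} \<times> {0..1})) B h"
    and "e \<in> topspace E" "p e = h (0,0)"
  obtains k where "continuous_map (top_of_set ({0..1} \<times> {0..1})) E k" "k (0,0) = e"
    "\<And>w. w \<in> {0..1} \<times> {0..1} \<Longrightarrow> p (k w) = h w"
proof -
  have "liftable E p ({0..1} \<times> {0..1}) h"
    using liftable_rectangle [OF assms(1,2)] by simp
  moreover have "(0::real, 0::real) \<in> {0..1} \<times> {0..1}" by simp
  ultimately show ?thesis
    using assms(3,4) that unfolding liftable_def by blast
qed

text \<open>A path is a homotopy that does not depend on its first coordinate: lift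
  \<open>f \<circ> snd\<close> over the square and restrict to the edge where the first coordinate
  is 0.\<close>

lemma covering_map_path_lifting:
  assumes p: "covering_map E B p" and f: "pathin B f" and e: "e \<in> topspace E" "p e = f 0"
  obtains k where "pathin E k" "k 0 = e" "\<And>t. t \<in> {0..1} \<Longrightarrow> p (k t) = f t"
proof -
  have "continuous_map (top_of_set ({0..1} \<times> {0..1})) (top_of_set {0..1}) (snd :: real \<times> real \<Rightarrow> real)"
    by (auto simp: continuous_map_in_subtopology intro!: continuous_intros)
  then have h: "continuous_map (top_of_set ({0..1} \<times> {0..1})) B (f \<circ> (snd :: real \<times> real \<Rightarrow> real))"
    using f continuous_map_compose unfolding pathin_def by blast
  obtain k :: "real \<times> real \<Rightarrow> 'a" where k: "continuous_map (top_of_set ({0..1} \<times> {0..1})) E k" "k (0,0) = e"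
    "\<And>w. w \<in> {0..1} \<times> {0..1} \<Longrightarrow> p (k w) = (f \<circ> snd) w"
    using covering_map_homotopy_lifting [OF p h e(1)] e(2) by auto
  have "continuous_map (top_of_set {0..1}) (top_of_set ({0..1} \<times> {0..1})) (Pair 0 :: real \<Rightarrow> real \<times> real)"
    by (auto simp: continuous_map_in_subtopology intro!: continuous_intros)
  then have "pathin E (k \<circ> Pair 0)"
    using k(1) continuous_map_compose unfolding pathin_def by blast
  with k show ?thesis by (intro that [of "k \<circ> Pair 0"]) auto
qed

section \<open>Configuration spaces are covered\<close>

lemma topspace_ordered_config:
  "topspace (ordered_config n X) = ({1..n} \<rightarrow>\<^sub>E topspace X) \<inter> {y. inj_on y {1..n}}"
  by (simp add: ordered_config_def topspace_product_topology)

lemma continuous_map_ordered_config_component: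
  assumes "i \<in> {1..n}"
  shows "continuous_map (ordered_config n X) X (\<lambda>y. y i)"
  unfolding ordered_config_def
  using assms by (intro continuous_map_from_subtopology continuous_map_product_projection)

lemma permute_in_ordered_config:
  assumes "\<sigma> permutes {1..n}" "y \<in> topspace (ordered_config n X)"
  shows "y \<circ> \<sigma> \<in> topspace (ordered_config n X)"
proof -
  have "inj_on (y \<circ> \<sigma>) {1..n}"
    using assms by (auto simp: topspace_ordered_config permutes_image permutes_inj_on intro!: comp_inj_on)
  \<comment> \<open>Outside \<open>{1..n}\<close> the permutation is the identity, so
    \<open>y \<circ> \<sigma>\<close> remains \<open>undefined\<close> there and is still
    extensional.\<close>
  moreover have "y \<circ> \<sigma> \<in> {1..n} \<rightarrow>\<^sub>E topspace X"
    using assms permutes_in_image [OF assms(1)] permutes_not_in [OF assms(1)]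
    by (force simp: topspace_ordered_config PiE_iff extensional_def)
  ultimately show ?thesis by (simp add: topspace_ordered_config)
qed

lemma continuous_map_permute_ordered_config:
  assumes "\<sigma> permutes {1..n}"
  shows "continuous_map (ordered_config n X) (ordered_config n X) (\<lambda>y. y \<circ> \<sigma>)"
proof -
  have "continuous_map (ordered_config n X) (product_topology (\<lambda>i. X) {1..n}) (\<lambda>y. y \<circ> \<sigma>)"
    unfolding continuous_map_componentwise
  proof (intro conjI ballI)
    show "(\<lambda>y. y \<circ> \<sigma>) ` topspace (ordered_config n X) \<subseteq> extensional {1..n}"
      using permute_in_ordered_config [OF assms] by (fastforce simp: topspace_ordered_config PiE_iff)
    show "continuous_map (ordered_config n X) X (\<lambda>y. (y \<circ> \<sigma>) k)" if "k \<in> {1..n}" for k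
      using continuous_map_ordered_config_component [of "\<sigma> k" n X] permutes_in_image [OF assms] that
      by simp
  qed
  then show ?thesis
    using permute_in_ordered_config [OF assms]
    by (subst (2) ordered_config_def) (auto simp: continuous_map_in_subtopology topspace_ordered_config)
qed

lemma config_class_eq_iff:
  "config_class n y = config_class n z \<longleftrightarrow> (\<exists>\<sigma>. \<sigma> permutes {1..n} \<and> z = y \<circ> \<sigma>)"
proof
  assume "config_class n y = config_class n z"
  moreover have "z \<in> config_class n z"
    unfolding config_class_def using permutes_id by (metis (mono_tags, lifting) comp_id mem_Collect_eq)
  ultimately show "\<exists>\<sigma>. \<sigma> permutes {1..n} \<and> z = y \<circ> \<sigma>"
    by (auto simp: config_class_def)
next
  assume "\<exists>\<sigma>. \<sigma> permutes {1..n} \<and> z = y \<circ> \<sigma>"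
  then obtain \<sigma> where \<sigma>: "\<sigma> permutes {1..n}" "z = y \<circ> \<sigma>" by blast
  have "y \<circ> \<tau> \<in> config_class n z" if "\<tau> permutes {1..n}" for \<tau>
  proof -
    have "y \<circ> \<tau> = z \<circ> (inv_into UNIV \<sigma> \<circ> \<tau>)"
      using \<sigma> by (simp add: comp_assoc permutes_inv_o flip: comp_assoc [of \<sigma> "inv_into UNIV \<sigma>" \<tau>])
    then show ?thesis
      unfolding config_class_def using \<sigma>(1) that permutes_compose permutes_inv by blast
  qed
  moreover have "z \<circ> \<tau> \<in> config_class n y" if "\<tau> permutes {1..n}" for \<tau>
    unfolding config_class_def using \<sigma> that permutes_compose by (auto simp: comp_assoc)
  ultimately show "config_class n y = config_class n z"
    by (auto simp: config_class_def)
qed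

text \<open>The saturation of an open set is the union of its preimages under the permutation
  action, which are open because each permutation acts continuously.\<close>

lemma open_map_config_class:
  "open_map (ordered_config n X) (unordered_config n X) (config_class n)"
  unfolding open_map_def unordered_config_def openin_quotient_topology
proof (intro allI impI conjI)
  fix W assume W: "openin (ordered_config n X) W"
  then show "config_class n ` W \<subseteq> config_class n ` topspace (ordered_config n X)"
    using openin_subset by blast
  have "{y \<in> topspace (ordered_config n X). config_class n y \<in> config_class n ` W}
      = (\<Union>\<sigma>\<in>{\<sigma>. \<sigma> permutes {1..n}}. {y \<in> topspace (ordered_config n X). y \<circ> \<sigma> \<in> W})"
    by (auto simp: image_iff config_class_eq_iff)
  moreover have "openin (ordered_config n X) {y \<in> topspace (ordered_config n X). y \<circ> \<sigma> \<in> W}"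
    if "\<sigma> permutes {1..n}" for \<sigma>
    using openin_continuous_map_preimage [OF continuous_map_permute_ordered_config [OF that] W] .
  ultimately show "openin (ordered_config n X)
      {y \<in> topspace (ordered_config n X). config_class n y \<in> config_class n ` W}"
    by auto
qed

lemma Hausdorff_space_separate_finite:
  assumes "Hausdorff_space X" "finite I" "y ` I \<subseteq> topspace X" "inj_on y I"
  obtains U where "\<And>i. i \<in> I \<Longrightarrow> openin X (U i) \<and> y i \<in> U i"
    "\<And>i j. \<lbrakk>i \<in> I; j \<in> I; i \<noteq> j\<rbrakk> \<Longrightarrow> disjnt (U i) (U j)"
proof -
  have "\<exists>A B. openin X A \<and> openin X B \<and> y i \<in> A \<and> y j \<in> B \<and> disjnt A B"
    if "i \<in> I" "j \<in> I" "i \<noteq> j" for i j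
  proof -
    have "y i \<in> topspace X" "y j \<in> topspace X" "y i \<noteq> y j"
      using assms(3,4) that by (auto simp: inj_on_eq_iff)
    then show ?thesis using assms(1) by (simp add: Hausdorff_space_def)
  qed
  then obtain A B where AB: "\<And>i j. \<lbrakk>i \<in> I; j \<in> I; i \<noteq> j\<rbrakk> \<Longrightarrow>
      openin X (A i j) \<and> openin X (B i j) \<and> y i \<in> A i j \<and> y j \<in> B i j \<and> disjnt (A i j) (B i j)"
    by metis
  \<comment> \<open>The chosen pairs need not be symmetric in \<open>i\<close> and \<open>j\<close>.
    Both \<open>A i j\<close> and \<open>B j i\<close> are neighbourhoods of \<open>y i\<close>, and
    meeting them both gives \<open>U i \<subseteq> A i j\<close> and
    \<open>U j \<subseteq> B i j\<close> for every ordered pair. The factor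
    \<open>topspace X\<close> covers the case of a single index, where the intersection is over the
    empty family.\<close>
  define U where "U i = topspace X \<inter> \<Inter> ((\<lambda>j. A i j \<inter> B j i) ` (I - {i}))" for i
  have "openin X (U i) \<and> y i \<in> U i" if "i \<in> I" for i
  proof
    show "openin X (U i)"
      unfolding U_def using assms AB that by (intro openin_Int_Inter) auto
    show "y i \<in> U i"
      unfolding U_def using assms AB that by auto
  qed
  moreover have "disjnt (U i) (U j)" if "i \<in> I" "j \<in> I" "i \<noteq> j" for i j
  proof -
    have "U i \<subseteq> A i j" "U j \<subseteq> B i j" using that by (auto simp: U_def)
    then show ?thesis using AB [OF that] by (meson disjnt_subset1 disjnt_subset2)
  qed
  ultimately show ?thesis by (rule that)
qed

text \<open>With the points of \<open>y\<close> separated by disjoint sets \<open>U i\<close>, a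
  point lying in some \<open>U i\<close> determines \<open>i\<close>. This one fact makes the sheets
  disjoint and \<open>config_class n\<close> injective on each of them. Permutations carry sheets to
  sheets, so all sheets have the same image, which is open because the quotient map is open.\<close>

lemma covering_map_config_class:
  assumes "Hausdorff_space X"
  shows "covering_map (ordered_config n X) (unordered_config n X) (config_class n)"
  unfolding covering_map_def
proof (intro conjI ballI)
  let ?F = "ordered_config n X" and ?C = "unordered_config n X" and ?p = "config_class n"
  show cont: "continuous_map ?F ?C ?p"
    unfolding unordered_config_def
    by (rule quotient_imp_continuous_map [OF quotient_map_quotient_topology])
  fix b assume "b \<in> topspace ?C"
  then obtain y where y: "y \<in> topspace ?F" "b = ?p y"
    by (auto simp: unordered_config_def topspace_quotient_topology)
  obtain U where U: "\<And>i. i \<in> {1..n} \<Longrightarrow> openin X (U i) \<and> y i \<in> U i"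
      "\<And>i j. \<lbrakk>i \<in> {1..n}; j \<in> {1..n}; i \<noteq> j\<rbrakk> \<Longrightarrow> disjnt (U i) (U j)"
    using Hausdorff_space_separate_finite [OF assms, of "{1..n}" y] y
    by (auto simp: topspace_ordered_config)
  \<comment> \<open>\<open>V \<sigma>\<close> consists of the configurations whose
    \<open>i\<close>-th point is close to \<open>y (\<sigma> i)\<close>; \<open>V id\<close> is the
    sheet through \<open>y\<close>.\<close>
  define V where "V \<sigma> = {z \<in> topspace ?F. \<forall>i\<in>{1..n}. z i \<in> U (\<sigma> i)}" for \<sigma> :: "nat \<Rightarrow> nat"
  have U_eq: "i = j" if "i \<in> {1..n}" "j \<in> {1..n}" "u \<in> U i" "u \<in> U j" for i j u
    using U(2) that by (meson disjnt_iff)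
  have openV: "openin ?F (V \<sigma>)" if "\<sigma> permutes {1..n}" for \<sigma>
  proof -
    have "V \<sigma> = topspace ?F \<inter> (\<Inter>i\<in>{1..n}. {z \<in> topspace ?F. z i \<in> U (\<sigma> i)})"
      by (auto simp: V_def)
    moreover have "openin ?F {z \<in> topspace ?F. z i \<in> U (\<sigma> i)}" if "i \<in> {1..n}" for i
      using U(1) permutes_in_image [OF \<open>\<sigma> permutes {1..n}\<close>] that
      by (intro openin_continuous_map_preimage [OF continuous_map_ordered_config_component]) auto
    ultimately show ?thesis
      by (auto intro: openin_Int_Inter)
  qed
  have V_comp: "z \<circ> \<tau> \<in> V (\<sigma> \<circ> \<tau>)" if "z \<in> V \<sigma>" "\<tau> permutes {1..n}" for z \<sigma> \<tau>
    using that permutes_in_image [OF that(2)] permute_in_ordered_config [OF that(2), of z]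
    by (auto simp: V_def)
  have image: "?p ` V \<sigma> = ?p ` V id" if \<sigma>: "\<sigma> permutes {1..n}" for \<sigma>
  proof -
    have p_comp: "?p (z \<circ> \<tau>) = ?p z" if "\<tau> permutes {1..n}" for z \<tau>
      using config_class_eq_iff that by metis
    have "?p z \<in> ?p ` V id" if "z \<in> V \<sigma>" for z
    proof -
      have "z \<circ> inv_into UNIV \<sigma> \<in> V id"
        using V_comp [OF that permutes_inv [OF \<sigma>]] \<sigma> by (simp add: permutes_inv_o)
      then show ?thesis
        using p_comp [OF permutes_inv [OF \<sigma>], of z] by (metis imageI)
    qed
    moreover have "?p z \<in> ?p ` V \<sigma>" if "z \<in> V id" for z
      using V_comp [OF that \<sigma>] p_comp [OF \<sigma>, of z] by (metis id_comp imageI)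
    ultimately show ?thesis by blast
  qed
  \<comment> \<open>If \<open>w = z \<circ> \<tau>\<close> with both in \<open>V \<sigma>\<close>,
    then \<open>w i\<close> lies in \<open>U (\<sigma> (\<tau> i))\<close> and in
    \<open>U (\<sigma> i)\<close>, which forces \<open>\<tau>\<close> to be the identity.\<close>
  have inj: "inj_on ?p (V \<sigma>)" if "\<sigma> permutes {1..n}" for \<sigma>
  proof (rule inj_onI)
    fix z w assume z: "z \<in> V \<sigma>" and w: "w \<in> V \<sigma>" and "?p z = ?p w"
    then obtain \<tau> where \<tau>: "\<tau> permutes {1..n}" "w = z \<circ> \<tau>"
      using config_class_eq_iff by blast
    have "\<tau> i = i" for i
    proof (cases "i \<in> {1..n}")
      case True
      then have i: "\<tau> i \<in> {1..n}" using permutes_in_image [OF \<tau>(1)] by blast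
      then have "w i \<in> U (\<sigma> (\<tau> i))" "w i \<in> U (\<sigma> i)"
        using z w True \<tau> by (auto simp: V_def)
      then have "\<sigma> (\<tau> i) = \<sigma> i"
        using U_eq i True permutes_in_image [OF that] by blast
      then show ?thesis using permutes_inj [OF that] by (simp add: inj_eq)
    qed (use permutes_not_in [OF \<tau>(1)] in simp)
    then show "z = w" using \<tau> by (simp add: comp_def)
  qed
  have disj: "disjnt (V \<sigma>) (V \<tau>)"
    if "\<sigma> permutes {1..n}" "\<tau> permutes {1..n}" "\<sigma> \<noteq> \<tau>" for \<sigma> \<tau>
  proof -
    have "\<sigma> i = \<tau> i" if z: "z \<in> V \<sigma>" "z \<in> V \<tau>" for z i
    proof (cases "i \<in> {1..n}")
      case True
      then show ?thesis
        using z U_eq [of "\<sigma> i" "\<tau> i" "z i"] permutes_in_image [OF \<open>\<sigma> permutes {1..n}\<close>]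
          permutes_in_image [OF \<open>\<tau> permutes {1..n}\<close>] unfolding V_def by blast
    qed (use permutes_not_in [OF \<open>\<sigma> permutes {1..n}\<close>] permutes_not_in [OF \<open>\<tau> permutes {1..n}\<close>] in simp)
    then show ?thesis using \<open>\<sigma> \<noteq> \<tau>\<close> unfolding disjnt_iff by blast
  qed
  have preimage: "(\<Union>\<sigma>\<in>{\<sigma>. \<sigma> permutes {1..n}}. V \<sigma>) = {z \<in> topspace ?F. ?p z \<in> ?p ` V id}"
  proof (rule subset_antisym; rule subsetI)
    fix z assume "z \<in> (\<Union>\<sigma>\<in>{\<sigma>. \<sigma> permutes {1..n}}. V \<sigma>)"
    then show "z \<in> {z \<in> topspace ?F. ?p z \<in> ?p ` V id}"
      using image by (auto simp: V_def)
  next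
    fix z assume "z \<in> {z \<in> topspace ?F. ?p z \<in> ?p ` V id}"
    then obtain w where "w \<in> V id" "?p w = ?p z" by auto
    then obtain \<sigma> where "\<sigma> permutes {1..n}" "z = w \<circ> \<sigma>"
      using config_class_eq_iff by blast
    then show "z \<in> (\<Union>\<sigma>\<in>{\<sigma>. \<sigma> permutes {1..n}}. V \<sigma>)"
      using V_comp [OF \<open>w \<in> V id\<close>] by auto
  qed
  have openT: "openin ?C (?p ` V id)"
    using open_map_config_class openV [OF permutes_id] by (auto simp: open_map_def)
  have homeo: "homeomorphic_map (subtopology ?F (V \<sigma>)) (subtopology ?C (?p ` V id)) ?p"
    if \<sigma>: "\<sigma> permutes {1..n}" for \<sigma>
  proof (rule bijective_open_imp_homeomorphic_map)
    have sub: "V \<sigma> \<subseteq> topspace ?F" by (auto simp: V_def)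
    show "continuous_map (subtopology ?F (V \<sigma>)) (subtopology ?C (?p ` V id)) ?p"
      using cont image [OF \<sigma>] by (auto simp: continuous_map_in_subtopology continuous_map_from_subtopology)
    show "open_map (subtopology ?F (V \<sigma>)) (subtopology ?C (?p ` V id)) ?p"
      unfolding open_map_def
    proof (intro allI impI)
      fix W assume "openin (subtopology ?F (V \<sigma>)) W"
      then have W: "openin ?F W" "W \<subseteq> V \<sigma>"
        using openV [OF \<sigma>] by (auto simp: openin_open_subtopology)
      then have "openin ?C (?p ` W)"
        using open_map_config_class by (auto simp: open_map_def)
      then show "openin (subtopology ?C (?p ` V id)) (?p ` W)"
        using W(2) image [OF \<sigma>] openT by (auto simp: openin_open_subtopology)
    qed
    show "?p ` topspace (subtopology ?F (V \<sigma>)) = topspace (subtopology ?C (?p ` V id))"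
      using sub image [OF \<sigma>] openin_subset [OF openT] by (simp add: Int_absorb1)
    show "inj_on ?p (topspace (subtopology ?F (V \<sigma>)))"
      using inj [OF \<sigma>] by (simp add: inj_on_Int)
  qed
  show "\<exists>T \<V>. openin ?C T \<and> b \<in> T \<and> \<Union>\<V> = {e \<in> topspace ?F. ?p e \<in> T} \<and> pairwise disjnt \<V> \<and>
      (\<forall>V\<in>\<V>. openin ?F V \<and> homeomorphic_map (subtopology ?F V) (subtopology ?C T) ?p)"
  proof (intro exI conjI)
    show "openin ?C (?p ` V id)" by (rule openT)
    show "b \<in> ?p ` V id" using y U(1) by (auto simp: V_def)
    show "\<Union> (V ` {\<sigma>. \<sigma> permutes {1..n}}) = {e \<in> topspace ?F. ?p e \<in> ?p ` V id}"
      by (rule preimage)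
    show "pairwise disjnt (V ` {\<sigma>. \<sigma> permutes {1..n}})"
      unfolding pairwise_def using disj by blast
    show "\<forall>N\<in>V ` {\<sigma>. \<sigma> permutes {1..n}}. openin ?F N \<and>
        homeomorphic_map (subtopology ?F N) (subtopology ?C (?p ` V id)) ?p"
      using openV homeo by blast
  qed
qed

section \<open>Paths as singular 1-chains\<close>

lemma path_simplex_cong:
  assumes "\<And>t. t \<in> {0..1} \<Longrightarrow> p t = q t"
  shows "path_simplex p = path_simplex q"
  using assms unfolding path_simplex_def
  by (intro restrict_ext) (auto simp: standard_simplex_def)

lemma singular_simplex_path_simplex:
  assumes "pathin X p"
  shows "singular_simplex 1 X (path_simplex p)"
proof -
  have "continuous_map (subtopology (powertop_real UNIV) (standard_simplex 1)) (top_of_set {0..1}) (\<lambda>v. v 1)"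
    by (auto simp: continuous_map_in_subtopology standard_simplex_def intro!: continuous_intros)
  then have "continuous_map (subtopology (powertop_real UNIV) (standard_simplex 1)) X (p \<circ> (\<lambda>v. v 1))"
    using assms continuous_map_compose unfolding pathin_def by blast
  then show ?thesis
    by (simp add: singular_simplex_def path_simplex_def comp_def)
qed

lemma chain_boundary_path_simplex:
  "chain_boundary 1 (frag_of (path_simplex p)) =
     frag_of (restrict (\<lambda>_. p 1) (standard_simplex 0)) - frag_of (restrict (\<lambda>_. p 0) (standard_simplex 0))"
proof -
  \<comment> \<open>Face 0 omits vertex 0 and so is the endpoint with coordinate
    \<open>v 1 = 1\<close>; this gives \<open>p 1\<close> the positive sign.\<close>
  have "singular_face 1 0 (path_simplex p) = restrict (\<lambda>_. p 1) (standard_simplex 0)"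
    "singular_face 1 1 (path_simplex p) = restrict (\<lambda>_. p 0) (standard_simplex 0)"
    unfolding path_simplex_def singular_face_def
    by (auto simp: simplical_face_def standard_simplex_def fun_eq_iff restrict_def)
  then show ?thesis
    by (simp add: chain_boundary_of)
qed

text \<open>A singular 2-simplex with vertices 0, 1, 2 is written in the coordinates
  \<open>(v\<^sub>1 + v\<^sub>2, v\<^sub>2)\<close>, which turn the standard simplex into the triangle below the diagonal of the
  unit square.\<close>

lemma homologous_triangle_edges:
  fixes f :: "real \<times> real \<Rightarrow> 'a"
  assumes f: "continuous_map (top_of_set {(s, t). 0 \<le> t \<and> t \<le> s \<and> s \<le> 1}) X f"
  shows "homologous_rel 1 X {}
           (frag_of (path_simplex (\<lambda>t. f (t, 0))) + frag_of (path_simplex (\<lambda>t. f (1, t))))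
           (frag_of (path_simplex (\<lambda>t. f (t, t))))"
proof -
  let ?S = "subtopology (powertop_real UNIV) (standard_simplex 2)"
  let ?T = "{(s, t). 0 \<le> t \<and> t \<le> s \<and> s \<le> (1::real)}"
  define \<tau> where "\<tau> = restrict (\<lambda>v. f (v 1 + v 2, v 2)) (standard_simplex 2)"
  have sum2: "sum v {..2} = v 0 + v 1 + v 2" for v :: "nat \<Rightarrow> real"
    by (simp add: numeral_2_eq_2)
  have "continuous_map ?S euclidean (\<lambda>v. (v 1 + v 2, v 2) :: real \<times> real)"
    unfolding prod_topology_euclidean [symmetric] by (intro continuous_intros) auto
  moreover have "(v 1 + v 2, v 2) \<in> ?T" if "v \<in> standard_simplex 2" for v :: "nat \<Rightarrow> real"
  proof -
    have "0 \<le> v 0" "0 \<le> v 1" "0 \<le> v 2" "v 0 + v 1 + v 2 = 1"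
      using that sum2 [of v] by (simp_all add: standard_simplex_def)
    then show ?thesis by simp
  qed
  ultimately have "continuous_map ?S (top_of_set ?T) (\<lambda>v. (v 1 + v 2, v 2))"
    by (auto simp: continuous_map_in_subtopology)
  from continuous_map_compose [OF this f] have "singular_simplex 2 X \<tau>"
    by (simp add: singular_simplex_def \<tau>_def comp_def)
  moreover have face: "singular_face 2 k \<tau> = restrict ((\<lambda>v. f (v 1 + v 2, v 2)) \<circ> simplical_face k) (standard_simplex 1)"
    if "k \<le> 2" for k
    unfolding \<tau>_def singular_face_restrict [OF pos2 that] by (simp add: singular_face_def)
  \<comment> \<open>The vertices go to (0,0), (1,0) and (1,1), so the faces opposite vertices 0, 1,
    2 are the right side, the diagonal and the bottom side. Their signs +, -, + put the diagonal
    alone on one side of the relation.\<close>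
  have "singular_face 2 0 \<tau> = path_simplex (\<lambda>t. f (1, t))"
    "singular_face 2 1 \<tau> = path_simplex (\<lambda>t. f (t, t))"
    "singular_face 2 2 \<tau> = path_simplex (\<lambda>t. f (t, 0))"
    by (auto simp: face path_simplex_def simplical_face_def standard_simplex_def fun_eq_iff restrict_def)
  then have "chain_boundary 2 (frag_of \<tau>) = frag_of (path_simplex (\<lambda>t. f (t, 0))) +
      frag_of (path_simplex (\<lambda>t. f (1, t))) - frag_of (path_simplex (\<lambda>t. f (t, t)))"
    by (simp add: chain_boundary_of numeral_2_eq_2)
  ultimately show ?thesis
    unfolding homologous_rel_def singular_boundary
    by (intro exI [of _ "frag_of \<tau>"]) (simp add: singular_chain_of numeral_2_eq_2)
qed

text \<open>All three edges of a constant triangle are the same simplex \<open>c\<close>, so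
  \<open>c + c\<close> is homologous to \<open>c\<close> and one copy cancels.\<close>

lemma null_homologous_const_path:
  assumes "a \<in> topspace X"
  shows "homologous_rel 1 X {} (frag_of (path_simplex (\<lambda>_. a))) 0"
proof -
  have "homologous_rel 1 X {}
      (frag_of (path_simplex (\<lambda>_. a)) + frag_of (path_simplex (\<lambda>_. a))) (frag_of (path_simplex (\<lambda>_. a)))"
    using homologous_triangle_edges [of X "\<lambda>_. a"] assms by simp
  then show ?thesis
    by (simp add: homologous_rel_def)
qed

text \<open>The diagonal cuts the square into two triangles that share it as an edge, one of them
  reflected to fit the standard triangle. Comparing the two gives equality up to the edges where the
  path parameter is 0 or 1; these are constant paths, hence null-homologous.\<close>

lemma homologous_path_homotopy:
  fixes h :: "real \<times> real \<Rightarrow> 'a"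
  assumes h: "continuous_map (top_of_set ({0..1} \<times> {0..1})) X h"
    and start: "\<And>s. s \<in> {0..1} \<Longrightarrow> h (s, 0) = a" and finish: "\<And>s. s \<in> {0..1} \<Longrightarrow> h (s, 1) = b"
  shows "homologous_rel 1 X {} (frag_of (path_simplex (\<lambda>t. h (0, t)))) (frag_of (path_simplex (\<lambda>t. h (1, t))))"
proof -
  let ?T = "{(s, t). 0 \<le> t \<and> t \<le> s \<and> s \<le> (1::real)}"
  have "h (0,0) \<in> topspace X" "h (0,1) \<in> topspace X"
    using h by (auto simp: continuous_map_def Pi_iff)
  then have ab: "a \<in> topspace X" "b \<in> topspace X"
    using start [of 0] finish [of 0] by auto
  have "continuous_map (top_of_set ?T) (top_of_set ({0..1} \<times> {0..1})) (\<lambda>(s, t). (t, s))"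
    by (auto simp: continuous_map_in_subtopology case_prod_unfold intro!: continuous_intros)
  from continuous_map_compose [OF this h]
  have "continuous_map (top_of_set ?T) X (\<lambda>(s, t). h (t, s))"
    by (simp add: comp_def case_prod_unfold)
  from homologous_triangle_edges [OF this]
  have *: "homologous_rel 1 X {}
      (frag_of (path_simplex (\<lambda>t. h (0, t))) + frag_of (path_simplex (\<lambda>t. h (t, 1))))
      (frag_of (path_simplex (\<lambda>t. h (t, t))))"
    by simp
  have "continuous_map (top_of_set ?T) X h"
    by (rule continuous_map_from_subtopology_mono [OF h]) auto
  from homologous_triangle_edges [OF this]
  have **: "homologous_rel 1 X {}
      (frag_of (path_simplex (\<lambda>t. h (t, 0))) + frag_of (path_simplex (\<lambda>t. h (1, t))))
      (frag_of (path_simplex (\<lambda>t. h (t, t))))" .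
  have const: "path_simplex (\<lambda>t. h (t, 0)) = path_simplex (\<lambda>_. a)"
       "path_simplex (\<lambda>t. h (t, 1)) = path_simplex (\<lambda>_. b)"
    using start finish by (auto intro: path_simplex_cong)
  let ?p = "frag_of (path_simplex (\<lambda>t. h (0, t)))" and ?q = "frag_of (path_simplex (\<lambda>t. h (1, t)))"
  let ?A = "frag_of (path_simplex (\<lambda>_. a))" and ?B = "frag_of (path_simplex (\<lambda>_. b))"
  have "homologous_rel 1 X {} (?p + ?B) (?A + ?q)"
    using homologous_rel_trans [OF iffD1 [OF homologous_rel_sym **] *] unfolding const .
  moreover have A: "homologous_rel 1 X {} ?A 0" and B: "homologous_rel 1 X {} ?B 0"
    by (rule null_homologous_const_path [OF ab(1)] null_homologous_const_path [OF ab(2)])+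
  \<comment> \<open>From \<open>?p + ?B\<close> homologous to \<open>?A + ?q\<close>, subtract the
    relations \<open>?B\<close> to 0 and 0 to \<open>?A\<close>; what is left is \<open>?p\<close>
    and \<open>?q\<close>.\<close>
  ultimately have "homologous_rel 1 X {} ((?p + ?B) - ?B - 0) ((?A + ?q) - 0 - ?A)"
    by (intro homologous_rel_diff iffD1 [OF homologous_rel_sym A])
  then show ?thesis by simp
qed

lemma pathin_path_concat:
  assumes "pathin X p" "pathin X q" "p 1 = q 0"
  shows "pathin X (path_concat p q)"
  unfolding pathin_def path_concat_def
proof (rule continuous_map_cases_le)
  let ?I = "top_of_set {0..1::real}"
  have "continuous_map (subtopology ?I {t \<in> topspace ?I. t \<le> 1/2}) ?I (\<lambda>t. 2 * t)"
    "continuous_map (subtopology ?I {t \<in> topspace ?I. 1/2 \<le> t}) ?I (\<lambda>t. 2 * t - 1)"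
    by (auto simp: continuous_map_in_subtopology subtopology_subtopology intro!: continuous_intros)
  from this [THEN continuous_map_compose]
  show "continuous_map (subtopology ?I {t \<in> topspace ?I. t \<le> 1/2}) X (\<lambda>t. p (2 * t))"
    "continuous_map (subtopology ?I {t \<in> topspace ?I. 1/2 \<le> t}) X (\<lambda>t. q (2 * t - 1))"
    using assms by (auto simp: pathin_def comp_def)
  show "p (2 * t) = q (2 * t - 1)" if "t = 1/2" for t
    unfolding that using assms(3) by simp
qed (auto intro!: continuous_intros)

lemma homologous_path_concat:
  assumes p: "pathin X p" and q: "pathin X q" and pq: "p 1 = q 0"
  shows "homologous_rel 1 X {} (frag_of (path_simplex (path_concat p q)))
           (frag_of (path_simplex p) + frag_of (path_simplex q))"
proof -
  let ?T = "{(s, t). 0 \<le> t \<and> t \<le> s \<and> s \<le> (1::real)}"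
  \<comment> \<open>A map depending only on \<open>s + t\<close>: the bottom side of the triangle
    traverses the first half of the concatenation, the right side the second half, and the diagonal
    all of it.\<close>
  let ?f = "\<lambda>(s, t). path_concat p q ((s + t) / 2)"
  have "continuous_map (top_of_set ?T) (top_of_set {0..1}) (\<lambda>(s, t). (s + t) / 2)"
    by (auto simp: continuous_map_in_subtopology case_prod_unfold intro!: continuous_intros)
  from continuous_map_compose [OF this pathin_path_concat [OF assms, unfolded pathin_def]]
  have "continuous_map (top_of_set ?T) X ?f"
    by (simp add: comp_def case_prod_unfold)
  from homologous_triangle_edges [OF this]
  have "homologous_rel 1 X {}
     (frag_of (path_simplex (\<lambda>t. path_concat p q (t / 2))) + frag_of (path_simplex (\<lambda>t. path_concat p q ((1 + t) / 2))))
     (frag_of (path_simplex (path_concat p q)))"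
    by simp
  moreover have "path_simplex (\<lambda>t. path_concat p q (t / 2)) = path_simplex p"
    "path_simplex (\<lambda>t. path_concat p q ((1 + t) / 2)) = path_simplex q"
    using pq by (auto intro!: path_simplex_cong simp: path_concat_def add_divide_distrib)
  ultimately show ?thesis
    by (simp only: homologous_rel_sym)
qed

section \<open>The fundamental group\<close>

abbreviation homotopic_loops_at :: "'a topology \<Rightarrow> 'a \<Rightarrow> (real \<Rightarrow> 'a) \<Rightarrow> (real \<Rightarrow> 'a) \<Rightarrow> bool" where
  "homotopic_loops_at X b \<equiv> homotopic_with (\<lambda>r. r 0 = b \<and> r 1 = b) (top_of_set {0..1}) X"

text \<open>The first coordinate is the deformation parameter and the second the loop parameter. As
  in \<open>homotopic_with\<close>, the equations for \<open>p\<close> and \<open>q\<close> hold at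
  every real \<open>t\<close>, so later reparametrizations are identified as total functions and not
  just on the unit interval.\<close>

lemma homotopic_loops_at_square:
  fixes X :: "'a topology"
  shows "homotopic_loops_at X b p q \<longleftrightarrow>
     (\<exists>h :: real \<times> real \<Rightarrow> 'a. continuous_map (top_of_set ({0..1} \<times> {0..1})) X h \<and>
          (\<forall>t. h (0, t) = p t) \<and> (\<forall>t. h (1, t) = q t) \<and>
          (\<forall>s\<in>{0..1}. h (s, 0) = b \<and> h (s, 1) = b))"
  by (simp add: homotopic_with_def)

lemma homotopic_loops_at_imp_loops:
  assumes "homotopic_loops_at X b p q"
  shows "p \<in> loops_at X b" "q \<in> loops_at X b"
  using homotopic_with_imp_continuous_maps [OF assms] homotopic_with_imp_property [OF assms]
  by (auto simp: loops_at_def pathin_def)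

lemma loop_class_self: "p \<in> loops_at X b \<Longrightarrow> p \<in> loop_class X b p"
  by (simp add: loop_class_def loops_at_def pathin_def)

lemma loop_class_eqI:
  assumes "homotopic_loops_at X b p q"
  shows "loop_class X b p = loop_class X b q"
  unfolding loop_class_def
  using homotopic_with_trans [OF assms] homotopic_with_trans [OF homotopic_with_symD [OF assms]]
  by (intro Collect_cong iffI)

lemma path_concat_in_loops_at:
  "\<lbrakk>p \<in> loops_at X b; q \<in> loops_at X b\<rbrakk> \<Longrightarrow> path_concat p q \<in> loops_at X b"
  using pathin_path_concat [of X p q] by (auto simp: loops_at_def path_concat_def)

text \<open>The two homotopies are concatenated slice by slice; they fit together because both equal
  \<open>b\<close> on the line where the loop parameter is 1/2.\<close>

lemma homotopic_loops_at_path_concat: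
  assumes "homotopic_loops_at X b p p'" "homotopic_loops_at X b q q'"
  shows "homotopic_loops_at X b (path_concat p q) (path_concat p' q')"
proof -
  let ?Q = "top_of_set ({0..1::real} \<times> {0..1::real})"
  obtain f where f: "continuous_map ?Q X f" "\<And>t. f (0, t) = p t" "\<And>t. f (1, t) = p' t"
      "\<And>s. s \<in> {0..1} \<Longrightarrow> f (s, 0) = b \<and> f (s, 1) = b"
    using assms(1) unfolding homotopic_loops_at_square by blast
  obtain g where g: "continuous_map ?Q X g" "\<And>t. g (0, t) = q t" "\<And>t. g (1, t) = q' t"
      "\<And>s. s \<in> {0..1} \<Longrightarrow> g (s, 0) = b \<and> g (s, 1) = b"
    using assms(2) unfolding homotopic_loops_at_square by blast
  let ?h = "\<lambda>w. if snd w \<le> 1/2 then f (fst w, 2 * snd w) else g (fst w, 2 * snd w - 1)"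
  have "continuous_map ?Q X ?h"
  proof (rule continuous_map_cases_le)
    have "continuous_map (subtopology ?Q {w \<in> topspace ?Q. snd w \<le> 1/2}) ?Q (\<lambda>w. (fst w, 2 * snd w))"
      "continuous_map (subtopology ?Q {w \<in> topspace ?Q. 1/2 \<le> snd w}) ?Q (\<lambda>w. (fst w, 2 * snd w - 1))"
      by (auto simp: continuous_map_in_subtopology subtopology_subtopology intro!: continuous_intros)
    from this(1) [THEN continuous_map_compose, OF f(1)] this(2) [THEN continuous_map_compose, OF g(1)]
    show "continuous_map (subtopology ?Q {w \<in> topspace ?Q. snd w \<le> 1/2}) X (\<lambda>w. f (fst w, 2 * snd w))"
      "continuous_map (subtopology ?Q {w \<in> topspace ?Q. 1/2 \<le> snd w}) X (\<lambda>w. g (fst w, 2 * snd w - 1))"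
      by (simp_all add: comp_def)
    show "f (fst w, 2 * snd w) = g (fst w, 2 * snd w - 1)" if "w \<in> topspace ?Q" "snd w = 1/2" for w
      unfolding that(2) using f(4) [of "fst w"] g(4) [of "fst w"] that(1) by auto
  qed (auto intro!: continuous_intros)
  then show ?thesis
    unfolding homotopic_loops_at_square
    by (intro exI [of _ ?h]) (use f g in \<open>auto simp: path_concat_def\<close>)
qed

text \<open>The group laws hold up to a change of parameter, and any two parametrizations with the same
  endpoints are homotopic by convexity of the interval.\<close>

lemma homotopic_loops_at_reparam:
  assumes p: "pathin X p"
    and u: "continuous_on {0..1} u" "u \<in> {0..1} \<rightarrow> {0..1}"
    and v: "continuous_on {0..1} v" "v \<in> {0..1} \<rightarrow> {0..1}"
    and ends: "u 0 = v 0" "u 1 = v 1" "p (u 0) = b" "p (u 1) = b"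
  shows "homotopic_loops_at X b (p \<circ> u) (p \<circ> v)"
proof -
  let ?g = "\<lambda>w. (1 - fst w) * u (snd w) + fst w * v (snd w)"
  have "?g w \<in> {0..1}" if "w \<in> {0..1} \<times> {0..1}" for w
    using that u(2) v(2) convex_bound_le [of "u (snd w)" 1 "v (snd w)" "1 - fst w" "fst w"]
    by (auto simp: Pi_iff)
  moreover have "continuous_on ({0..1} \<times> {0..1}) ?g"
    by (intro continuous_intros continuous_on_compose2 [OF u(1)] continuous_on_compose2 [OF v(1)]) auto
  ultimately have "continuous_map (top_of_set ({0..1} \<times> {0..1})) (top_of_set {0..1}) ?g"
    by (auto simp: continuous_map_in_subtopology)
  from continuous_map_compose [OF this p [unfolded pathin_def]]
  show ?thesis
    unfolding homotopic_loops_at_square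
    by (intro exI [of _ "p \<circ> ?g"]) (use ends in \<open>auto simp: algebra_simps\<close>)
qed

lemma path_concat_assoc_homotopic:
  assumes "p \<in> loops_at X b" "q \<in> loops_at X b" "r \<in> loops_at X b"
  shows "homotopic_loops_at X b (path_concat (path_concat p q) r) (path_concat p (path_concat q r))"
proof -
  let ?c = "path_concat p (path_concat q r)"
  \<comment> \<open>The piecewise linear map taking 1/4 to 1/2 and 1/2 to 3/4. Its slopes 2, 1, 1/2
    decrease, so it is concave and equals the minimum of its three linear pieces.\<close>
  let ?u = "\<lambda>t::real. min (2 * t) (min (t + 1/4) ((t + 1) / 2))"
  have "?c \<in> loops_at X b"
    using assms by (intro path_concat_in_loops_at)
  then have "homotopic_loops_at X b (?c \<circ> ?u) (?c \<circ> (\<lambda>t. t))"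
    by (intro homotopic_loops_at_reparam continuous_intros) (auto simp: loops_at_def min_def)
  moreover have "?c \<circ> ?u = path_concat (path_concat p q) r"
  proof
    fix t :: real
    consider "t \<le> 1/4" | "1/4 < t" "t \<le> 1/2" | "1/2 < t" by linarith
    then show "(?c \<circ> ?u) t = path_concat (path_concat p q) r t"
    proof cases
      case 1
      then have "?u t = 2 * t" by (simp add: min_def)
      then show ?thesis using 1 by (simp add: path_concat_def)
    next
      case 2
      then have "?u t = t + 1/4" by (simp add: min_def)
      then show ?thesis using 2 by (simp add: path_concat_def)
    next
      case 3
      then have "?u t = (t + 1) / 2" by (simp add: min_def)
      then show ?thesis using 3 by (simp add: path_concat_def add_divide_distrib)
    qed
  qed
  ultimately show ?thesis by (simp add: comp_def)
qed

lemma path_concat_const_homotopic: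
  assumes "p \<in> loops_at X b"
  shows "homotopic_loops_at X b (path_concat (\<lambda>t. b) p) p"
proof -
  \<comment> \<open>Waits at 0 during the first half, then traverses the interval at double
    speed.\<close>
  let ?u = "\<lambda>t::real. max 0 (2 * t - 1)"
  have "homotopic_loops_at X b (p \<circ> ?u) (p \<circ> (\<lambda>t. t))"
    using assms by (intro homotopic_loops_at_reparam continuous_intros) (auto simp: loops_at_def)
  moreover have "p \<circ> ?u = path_concat (\<lambda>t. b) p"
  proof
    fix t :: real
    show "(p \<circ> ?u) t = path_concat (\<lambda>t. b) p t"
    proof (cases "t \<le> 1/2")
      case True
      then have "?u t = 0" by simp
      then show ?thesis using True assms by (simp add: path_concat_def loops_at_def)
    next
      case False
      then have "?u t = 2 * t - 1" by simp
      then show ?thesis using False by (simp add: path_concat_def)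
    qed
  qed
  ultimately show ?thesis by (simp add: comp_def)
qed

lemma reverse_in_loops_at:
  assumes "p \<in> loops_at X b"
  shows "p \<circ> (\<lambda>t. 1 - t) \<in> loops_at X b"
proof -
  have "continuous_map (top_of_set {0..1}) (top_of_set {0..1}) (\<lambda>t::real. 1 - t)"
    by (auto simp: continuous_map_in_subtopology intro!: continuous_intros)
  from continuous_map_compose [OF this, of X p] show ?thesis
    using assms by (auto simp: loops_at_def pathin_def)
qed

lemma path_concat_reverse_homotopic:
  assumes "p \<in> loops_at X b"
  shows "homotopic_loops_at X b (path_concat (p \<circ> (\<lambda>t. 1 - t)) p) (\<lambda>t. b)"
proof -
  \<comment> \<open>Runs from 1 down to 0 and back. Both ends are 1, so the comparison is with the
    constant parametrization 1.\<close>
  let ?u = "\<lambda>t::real. \<bar>2 * t - 1\<bar>"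
  have "homotopic_loops_at X b (p \<circ> ?u) (p \<circ> (\<lambda>t. 1))"
    using assms by (intro homotopic_loops_at_reparam continuous_intros) (auto simp: loops_at_def)
  moreover have "p \<circ> ?u = path_concat (p \<circ> (\<lambda>t. 1 - t)) p"
  proof
    fix t :: real
    show "(p \<circ> ?u) t = path_concat (p \<circ> (\<lambda>t. 1 - t)) p t"
    proof (cases "t \<le> 1/2")
      case True
      then have "?u t = 1 - 2 * t" by simp
      then show ?thesis using True by (simp add: path_concat_def)
    next
      case False
      then have "?u t = 2 * t - 1" by simp
      then show ?thesis using False by (simp add: path_concat_def)
    qed
  qed
  ultimately show ?thesis using assms by (simp add: comp_def loops_at_def)
qed

text \<open>The product is a union over all pairs of representatives. Concatenation respects
  homotopy, so every set in the union is the same class, and the union is not empty because a loop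
  belongs to its own class.\<close>

lemma mult_fundamental_group:
  assumes "p \<in> loops_at X b" "q \<in> loops_at X b"
  shows "loop_class X b p \<otimes>\<^bsub>fundamental_group X b\<^esub> loop_class X b q = loop_class X b (path_concat p q)"
proof -
  have eq: "loop_class X b (path_concat p' q') = loop_class X b (path_concat p q)"
    if "p' \<in> loop_class X b p" "q' \<in> loop_class X b q" for p' q'
  proof (rule loop_class_eqI [symmetric])
    show "homotopic_loops_at X b (path_concat p q) (path_concat p' q')"
      using that by (intro homotopic_loops_at_path_concat) (simp_all add: loop_class_def)
  qed
  have "(\<Union>p'\<in>loop_class X b p. \<Union>q'\<in>loop_class X b q. loop_class X b (path_concat p' q')) =
      (\<Union>p'\<in>loop_class X b p. \<Union>q'\<in>loop_class X b q. loop_class X b (path_concat p q))"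
    by (intro SUP_cong refl eq)
  also have "\<dots> = loop_class X b (path_concat p q)"
    using loop_class_self [OF assms(1)] loop_class_self [OF assms(2)] by blast
  finally show ?thesis
    by (simp add: fundamental_group_def)
qed

text \<open>\<open>groupI\<close> asks for a left unit and left inverses only, which is why the
  constant loop and the reversed loop stand first in the homotopies above.\<close>

lemma group_fundamental_group:
  assumes "b \<in> topspace X"
  shows "group (fundamental_group X b)"
proof (rule groupI)
  have carrier: "\<exists>p\<in>loops_at X b. a = loop_class X b p" if "a \<in> carrier (fundamental_group X b)" for a
    using that by (auto simp: fundamental_group_def)
  have class_in: "loop_class X b p \<in> carrier (fundamental_group X b)" if "p \<in> loops_at X b" for p
    using that by (simp add: fundamental_group_def)
  have one: "\<one>\<^bsub>fundamental_group X b\<^esub> = loop_class X b (\<lambda>t. b)"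
    by (simp add: fundamental_group_def)
  have const: "(\<lambda>t. b) \<in> loops_at X b"
    using assms by (simp add: loops_at_def)
  show "\<one>\<^bsub>fundamental_group X b\<^esub> \<in> carrier (fundamental_group X b)"
    unfolding one by (rule class_in [OF const])
  fix x assume "x \<in> carrier (fundamental_group X b)"
  then obtain p where p: "p \<in> loops_at X b" "x = loop_class X b p" using carrier by blast
  show "\<one>\<^bsub>fundamental_group X b\<^esub> \<otimes>\<^bsub>fundamental_group X b\<^esub> x = x"
    using p const by (simp add: one mult_fundamental_group loop_class_eqI path_concat_const_homotopic)
  show "\<exists>y\<in>carrier (fundamental_group X b). y \<otimes>\<^bsub>fundamental_group X b\<^esub> x = \<one>\<^bsub>fundamental_group X b\<^esub>"
  proof
    let ?y = "loop_class X b (p \<circ> (\<lambda>t. 1 - t))"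
    show "?y \<otimes>\<^bsub>fundamental_group X b\<^esub> x = \<one>\<^bsub>fundamental_group X b\<^esub>"
      unfolding one p(2) mult_fundamental_group [OF reverse_in_loops_at [OF p(1)] p(1)]
      by (intro loop_class_eqI path_concat_reverse_homotopic p(1))
    show "?y \<in> carrier (fundamental_group X b)"
      by (intro class_in reverse_in_loops_at p(1))
  qed
  fix y assume "y \<in> carrier (fundamental_group X b)"
  then obtain q where q: "q \<in> loops_at X b" "y = loop_class X b q" using carrier by blast
  show "x \<otimes>\<^bsub>fundamental_group X b\<^esub> y \<in> carrier (fundamental_group X b)"
    using p q class_in by (simp add: mult_fundamental_group path_concat_in_loops_at)
  fix z assume "z \<in> carrier (fundamental_group X b)"
  then obtain r where r: "r \<in> loops_at X b" "z = loop_class X b r" using carrier by blast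
  show "x \<otimes>\<^bsub>fundamental_group X b\<^esub> y \<otimes>\<^bsub>fundamental_group X b\<^esub> z =
        x \<otimes>\<^bsub>fundamental_group X b\<^esub> (y \<otimes>\<^bsub>fundamental_group X b\<^esub> z)"
    using p q r by (simp add: mult_fundamental_group path_concat_in_loops_at)
      (intro loop_class_eqI path_concat_assoc_homotopic)
qed

section \<open>Lifts of braids and their homology classes\<close>

lemma config_class_in_unordered_config:
  "x \<in> topspace (ordered_config n X) \<Longrightarrow> config_class n x \<in> topspace (unordered_config n X)"
  by (simp add: unordered_config_def topspace_quotient_topology)

lemma is_config_lift_unique:
  assumes X: "Hausdorff_space X"
    and "is_config_lift n X x \<phi> \<psi>" "is_config_lift n X x \<phi> \<psi>'" "t \<in> {0..1}"
  shows "\<psi> t = \<psi>' t"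
proof (rule covering_map_unique_lift [OF covering_map_config_class [OF X], where Z = "top_of_set {0..1}"
      and f = \<psi> and g = \<psi>' and ?z0.0 = 0])
  show "connected_space (top_of_set {0..1::real})"
    using connectedin_def connectedin_iff_connected connected_Icc by blast
qed (use assms in \<open>auto simp: is_config_lift_def pathin_def\<close>)

lemma ex1_config_lift:
  assumes X: "Hausdorff_space X" and x: "x \<in> topspace (ordered_config n X)"
    and \<phi>: "\<phi> \<in> loops_at (unordered_config n X) (config_class n x)"
  shows "\<exists>!\<psi>. \<psi> \<in> extensional {0..1} \<and> is_config_lift n X x \<phi> \<psi>"
proof -
  have "pathin (unordered_config n X) \<phi>" "config_class n x = \<phi> 0"
    using \<phi> by (auto simp: loops_at_def)
  then obtain \<psi> where \<psi>: "pathin (ordered_config n X) \<psi>" "\<psi> 0 = x"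
      "\<And>t. t \<in> {0..1} \<Longrightarrow> config_class n (\<psi> t) = \<phi> t"
    using covering_map_path_lifting [OF covering_map_config_class [OF X] _ x] by blast
  have "pathin (ordered_config n X) (restrict \<psi> {0..1})"
    using \<psi>(1) unfolding pathin_def by (rule continuous_map_eq) auto
  then have lift: "is_config_lift n X x \<phi> (restrict \<psi> {0..1})"
    using \<psi> by (simp add: is_config_lift_def)
  show ?thesis
  proof (rule ex1I [of _ "restrict \<psi> {0..1}"])
    fix \<psi>' assume \<psi>': "\<psi>' \<in> extensional {0..1} \<and> is_config_lift n X x \<phi> \<psi>'"
    show "\<psi>' = restrict \<psi> {0..1}"
      using \<psi>' by (intro extensionalityI [of _ "{0..1}"] is_config_lift_unique [OF X _ lift]) auto
  qed (simp add: lift)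
qed

lemma is_config_lift_config_lift:
  assumes "Hausdorff_space X" "x \<in> topspace (ordered_config n X)"
    and "\<phi> \<in> loops_at (unordered_config n X) (config_class n x)"
  shows "is_config_lift n X x \<phi> (config_lift n X x \<phi>)"
  using theI' [OF ex1_config_lift [OF assms]] by (simp add: config_lift_def)

text \<open>Frees later proofs from the definite description: any lift may be used to compute the
  chain, since simplices see only the unit interval and lifts agree there.\<close>

lemma lift_chain_eq:
  assumes "Hausdorff_space X" "x \<in> topspace (ordered_config n X)"
    and "\<phi> \<in> loops_at (unordered_config n X) (config_class n x)" "is_config_lift n X x \<phi> \<psi>"
  shows "lift_chain n X x \<phi> = (\<Sum>i=1..n. frag_of (path_simplex (\<lambda>t. \<psi> t i)))"
proof -
  have "path_simplex (\<lambda>t. config_lift n X x \<phi> t i) = path_simplex (\<lambda>t. \<psi> t i)" for i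
    using is_config_lift_unique [OF assms(1) is_config_lift_config_lift [OF assms(1-3)] assms(4)]
    by (intro path_simplex_cong) auto
  then show ?thesis by (simp add: lift_chain_def)
qed

text \<open>Both ends of the lift lie over the base configuration, so they differ by the permutation
  underlying the braid.\<close>

lemma is_config_lift_finish:
  assumes "\<phi> \<in> loops_at (unordered_config n X) (config_class n x)" "is_config_lift n X x \<phi> \<psi>"
  obtains \<sigma> where "\<sigma> permutes {1..n}" "\<psi> 1 = x \<circ> \<sigma>"
proof -
  have "config_class n x = config_class n (\<psi> 1)"
    using assms by (auto simp: loops_at_def is_config_lift_def)
  then show ?thesis using that by (auto simp: config_class_eq_iff)
qed

lemma pathin_config_component:
  assumes "pathin (ordered_config n X) \<psi>" "i \<in> {1..n}"
  shows "pathin X (\<lambda>t. \<psi> t i)"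
  using pathin_compose [OF assms(1) continuous_map_ordered_config_component [OF assms(2)]]
  by (simp add: comp_def)

text \<open>The \<open>i\<close>-th path has boundary \<open>x (\<sigma> i)\<close> minus
  \<open>x i\<close>; summed over all \<open>i\<close>, the two parts cancel after reindexing by
  \<open>\<sigma>\<close>.\<close>

lemma singular_relcycle_lift_chain:
  assumes X: "Hausdorff_space X" and x: "x \<in> topspace (ordered_config n X)"
    and \<phi>: "\<phi> \<in> loops_at (unordered_config n X) (config_class n x)"
  shows "singular_relcycle 1 X {} (lift_chain n X x \<phi>)"
proof -
  let ?\<psi> = "config_lift n X x \<phi>"
  let ?c = "\<lambda>a. frag_of (restrict (\<lambda>_. a) (standard_simplex 0))"
  have lift: "is_config_lift n X x \<phi> ?\<psi>"
    by (rule is_config_lift_config_lift [OF assms])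
  obtain \<sigma> where \<sigma>: "\<sigma> permutes {1..n}" "?\<psi> 1 = x \<circ> \<sigma>"
    using is_config_lift_finish [OF \<phi> lift] .
  have "singular_chain 1 X (lift_chain n X x \<phi>)"
    unfolding lift_chain_def
  proof (rule singular_chain_sum)
    fix i assume "i \<in> {1..n}"
    then have "pathin X (\<lambda>t. ?\<psi> t i)"
      using lift pathin_config_component by (auto simp: is_config_lift_def)
    then show "singular_chain 1 X (frag_of (path_simplex (\<lambda>t. ?\<psi> t i)))"
      unfolding singular_chain_of by (rule singular_simplex_path_simplex)
  qed
  moreover have "?\<psi> 0 = x" using lift by (simp add: is_config_lift_def)
  then have "chain_boundary 1 (lift_chain n X x \<phi>) = (\<Sum>i=1..n. ?c (x (\<sigma> i)) - ?c (x i))"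
    unfolding lift_chain_def chain_boundary_sum comp_def chain_boundary_path_simplex
    by (simp add: \<sigma>(2))
  moreover have "(\<Sum>i=1..n. ?c (x (\<sigma> i))) = (\<Sum>i=1..n. ?c (x i))"
    by (rule sum.reindex_bij_betw [OF permutes_imp_bij [OF \<sigma>(1)]])
  ultimately show ?thesis
    by (simp add: singular_cycle sum_subtractf)
qed

lemma homologous_lift_chain:
  assumes X: "Hausdorff_space X" and x: "x \<in> topspace (ordered_config n X)"
    and hom: "homotopic_loops_at (unordered_config n X) (config_class n x) \<phi> \<phi>'"
  shows "homologous_rel 1 X {} (lift_chain n X x \<phi>) (lift_chain n X x \<phi>')"
proof -
  let ?I = "top_of_set {0..1::real}" and ?Q = "top_of_set ({0..1::real} \<times> {0..1::real})"
  note cov = covering_map_config_class [OF X, of n]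
  obtain h where h: "continuous_map ?Q (unordered_config n X) h"
      "\<And>t. h (0, t) = \<phi> t" "\<And>t. h (1, t) = \<phi>' t"
      "\<And>s. s \<in> {0..1} \<Longrightarrow> h (s, 0) = config_class n x \<and> h (s, 1) = config_class n x"
    using hom unfolding homotopic_loops_at_square by blast
  obtain k where k: "continuous_map ?Q (ordered_config n X) k" "k (0, 0) = x"
      "\<And>w. w \<in> {0..1} \<times> {0..1} \<Longrightarrow> config_class n (k w) = h w"
    using covering_map_homotopy_lifting [OF cov h(1) x] h(4) [of 0] by auto
  have side: "continuous_map ?I (ordered_config n X) (\<lambda>t. k (s, t))"
      "continuous_map ?I (ordered_config n X) (\<lambda>t. k (t, s))" if "s \<in> {0..1}" for s
  proof -
    have "continuous_map ?I ?Q (\<lambda>t. (s, t))" "continuous_map ?I ?Q (\<lambda>t. (t, s))"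
      using that by (auto simp: continuous_map_in_subtopology intro!: continuous_intros)
    then show "continuous_map ?I (ordered_config n X) (\<lambda>t. k (s, t))"
      "continuous_map ?I (ordered_config n X) (\<lambda>t. k (t, s))"
      by (simp_all only: continuous_map_compose [OF _ k(1), unfolded comp_def])
  qed
  \<comment> \<open>On these two edges \<open>h\<close> is constantly the base configuration, so
    \<open>k\<close> there and the constant map at \<open>k (0, e)\<close> lift the same path and
    start at the same point. For \<open>e = 1\<close> the constant value is some reordering of
    \<open>x\<close>.\<close>
  have const: "k (s, e) = k (0, e)" if e: "e = 0 \<or> e = 1" and s: "s \<in> {0..1}" for s e
  proof (rule covering_map_unique_lift [OF cov, where Z = ?I and f = "\<lambda>s. k (s, e)"
        and g = "\<lambda>s. k (0, e)" and ?z0.0 = 0])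
    show "connected_space ?I"
      using connectedin_def connectedin_iff_connected connected_Icc by blast
    have e01: "e \<in> {0..1}" using e by auto
    then show "continuous_map ?I (ordered_config n X) (\<lambda>s. k (s, e))" by (rule side)
    then show "continuous_map ?I (ordered_config n X) (\<lambda>s. k (0, e))"
      by (auto simp: continuous_map_def)
    show "config_class n (k (z, e)) = config_class n (k (0, e))" if "z \<in> topspace ?I" for z
      using k(3) h(4) [of z] h(4) [of 0] e e01 that by auto
  qed (use s in auto)
  have "is_config_lift n X x \<phi> (\<lambda>t. k (0, t))"
    using side(1) [of 0] k h by (auto simp: is_config_lift_def pathin_def)
  \<comment> \<open>\<open>k\<close> was only prescribed at the corner (0,0); that the opposite edge
    starts at \<open>x\<close> as well is the case \<open>e = 0\<close> of
    \<open>const\<close>.\<close>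
  moreover have "is_config_lift n X x \<phi>' (\<lambda>t. k (1, t))"
    using side(1) [of 1] const [of 0 1] k h by (auto simp: is_config_lift_def pathin_def)
  moreover have "homologous_rel 1 X {} (\<Sum>i=1..n. frag_of (path_simplex (\<lambda>t. k (0, t) i)))
      (\<Sum>i=1..n. frag_of (path_simplex (\<lambda>t. k (1, t) i)))"
  proof (rule homologous_rel_sum)
    fix i assume i: "i \<in> {1..n}"
    have "continuous_map ?Q X (\<lambda>w. k w i)"
      using continuous_map_compose [OF k(1) continuous_map_ordered_config_component [OF i]]
      by (simp add: comp_def)
    then show "homologous_rel 1 X {} (frag_of (path_simplex (\<lambda>t. k (0, t) i)))
        (frag_of (path_simplex (\<lambda>t. k (1, t) i)))"
    proof (rule homologous_path_homotopy)
      show "k (s, 0) i = k (0, 0) i" "k (s, 1) i = k (0, 1) i" if "s \<in> {0..1}" for s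
        using const [of 0 s] const [of 1 s] that by auto
    qed
  qed auto
  ultimately show ?thesis
    using lift_chain_eq [OF X x] homotopic_loops_at_imp_loops [OF hom] by metis
qed

lemma homologous_lift_chain_concat:
  assumes X: "Hausdorff_space X" and x: "x \<in> topspace (ordered_config n X)"
    and \<phi>: "\<phi> \<in> loops_at (unordered_config n X) (config_class n x)"
    and \<phi>': "\<phi>' \<in> loops_at (unordered_config n X) (config_class n x)"
  shows "homologous_rel 1 X {} (lift_chain n X x (path_concat \<phi> \<phi>'))
           (lift_chain n X x \<phi> + lift_chain n X x \<phi>')"
proof -
  let ?\<psi> = "config_lift n X x \<phi>" and ?\<psi>' = "config_lift n X x \<phi>'"
  have lift: "is_config_lift n X x \<phi> ?\<psi>" and lift': "is_config_lift n X x \<phi>' ?\<psi>'"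
    using is_config_lift_config_lift [OF X x] \<phi> \<phi>' by auto
  obtain \<sigma> where \<sigma>: "\<sigma> permutes {1..n}" "?\<psi> 1 = x \<circ> \<sigma>"
    using is_config_lift_finish [OF \<phi> lift] .
  \<comment> \<open>The chosen lift of \<open>\<phi>'\<close> starts at \<open>x\<close>, whereas
    the first lift ends at \<open>x \<circ> \<sigma>\<close>. Relabelling by \<open>\<sigma>\<close>
    moves the start without changing the unordered configurations.\<close>
  have path: "pathin (ordered_config n X) ?\<psi>" "pathin (ordered_config n X) (\<lambda>t. ?\<psi>' t \<circ> \<sigma>)"
    using lift lift' pathin_compose [OF _ continuous_map_permute_ordered_config [OF \<sigma>(1)], of X ?\<psi>']
    by (auto simp: is_config_lift_def comp_def)
  have join: "?\<psi> 1 = ?\<psi>' 0 \<circ> \<sigma>"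
    using \<sigma>(2) lift' by (simp add: is_config_lift_def)
  have "config_class n (y \<circ> \<sigma>) = config_class n y" for y :: "nat \<Rightarrow> 'a"
    using config_class_eq_iff \<sigma>(1) by metis
  then have "is_config_lift n X x (path_concat \<phi> \<phi>') (path_concat ?\<psi> (\<lambda>t. ?\<psi>' t \<circ> \<sigma>))"
    unfolding is_config_lift_def
  proof (intro conjI pathin_path_concat path join)
  qed (use lift lift' in \<open>auto simp: is_config_lift_def path_concat_def\<close>)
  \<comment> \<open>A coordinate of the concatenated lift is the concatenation of coordinates
    \<open>i\<close> and \<open>\<sigma> i\<close> of the two lifts.\<close>
  then have "lift_chain n X x (path_concat \<phi> \<phi>') =
      (\<Sum>i=1..n. frag_of (path_simplex (path_concat (\<lambda>t. ?\<psi> t i) (\<lambda>t. ?\<psi>' t (\<sigma> i)))))"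
    using lift_chain_eq [OF X x path_concat_in_loops_at [OF \<phi> \<phi>']]
    by (auto simp: path_concat_def if_distrib [of "\<lambda>f. f _"] cong: if_cong)
  moreover have "homologous_rel 1 X {}
      (\<Sum>i=1..n. frag_of (path_simplex (path_concat (\<lambda>t. ?\<psi> t i) (\<lambda>t. ?\<psi>' t (\<sigma> i)))))
      (\<Sum>i=1..n. frag_of (path_simplex (\<lambda>t. ?\<psi> t i)) + frag_of (path_simplex (\<lambda>t. ?\<psi>' t (\<sigma> i))))"
  proof (rule homologous_rel_sum)
    fix i assume i: "i \<in> {1..n}"
    show "homologous_rel 1 X {}
      (frag_of (path_simplex (path_concat (\<lambda>t. ?\<psi> t i) (\<lambda>t. ?\<psi>' t (\<sigma> i)))))
      (frag_of (path_simplex (\<lambda>t. ?\<psi> t i)) + frag_of (path_simplex (\<lambda>t. ?\<psi>' t (\<sigma> i))))"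
    proof (rule homologous_path_concat)
      show "pathin X (\<lambda>t. ?\<psi> t i)" "pathin X (\<lambda>t. ?\<psi>' t (\<sigma> i))"
        using pathin_config_component [OF path(1) i] pathin_config_component [OF path(2) i] by auto
      show "?\<psi> 1 i = ?\<psi>' 0 (\<sigma> i)" by (simp add: join)
    qed
  qed auto
  moreover have "(\<Sum>i=1..n. frag_of (path_simplex (\<lambda>t. ?\<psi>' t (\<sigma> i)))) = lift_chain n X x \<phi>'"
    unfolding lift_chain_def by (rule sum.reindex_bij_betw [OF permutes_imp_bij [OF \<sigma>(1)]])
  ultimately show ?thesis
    by (simp add: sum.distrib lift_chain_def)
qed

text \<open>The product of two homology classes is their elementwise sum. A chain \<open>c\<close>
  homologous to \<open>a + b\<close> splits as \<open>a + (c - a)\<close>, and \<open>c - a\<close>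
  is homologous to \<open>b\<close>.\<close>

lemma mult_homologous_rel_set:
  "homologous_rel_set p X S a \<otimes>\<^bsub>relative_homology_group (int p) X S\<^esub> homologous_rel_set p X S b =
     homologous_rel_set p X S (a + b)"
proof -
  have "\<exists>r s. homologous_rel p X S a r \<and> homologous_rel p X S b s \<and> c = r + s"
    if "homologous_rel p X S (a + b) c" for c
    using that by (intro exI [of _ a] exI [of _ "c - a"]) (auto simp: homologous_rel_def algebra_simps)
  then show ?thesis
    by (auto simp: mult_relative_homology_group intro: homologous_rel_add)
qed

theorem proposition3p2:
  fixes X :: "'a topology" and g n :: nat and x :: "nat \<Rightarrow> 'a"
  assumes "closed_orientable_surface g X"
    and "n \<ge> 1"
    and "x \<in> topspace (ordered_config n X)"
  shows "(\<forall>\<phi>\<in>loops_at (unordered_config n X) (config_class n x).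
            (\<exists>!\<psi>. \<psi> \<in> extensional {0..1} \<and> is_config_lift n X x \<phi> \<psi>) \<and>
            singular_relcycle 1 X {} (lift_chain n X x \<phi>)) \<and>
         (\<forall>\<phi>\<in>loops_at (unordered_config n X) (config_class n x).
            \<forall>\<phi>'\<in>loops_at (unordered_config n X) (config_class n x).
              loop_class (unordered_config n X) (config_class n x) \<phi>
                = loop_class (unordered_config n X) (config_class n x) \<phi>' \<longrightarrow>
              homologous_rel_set 1 X {} (lift_chain n X x \<phi>)
                = homologous_rel_set 1 X {} (lift_chain n X x \<phi>')) \<and>
         (\<forall>\<phi>\<in>loops_at (unordered_config n X) (config_class n x).
            braid_homology n X x (loop_class (unordered_config n X) (config_class n x) \<phi>)
              = homologous_rel_set 1 X {} (lift_chain n X x \<phi>)) \<and>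
         group_hom (surface_braid_group n X x) (homology_group 1 X) (braid_homology n X x)"
proof -
  let ?C = "unordered_config n X" and ?b = "config_class n x"
  let ?cls = "\<lambda>\<phi>. homologous_rel_set 1 X {} (lift_chain n X x \<phi>)"
  note x = assms(3)
  have X: "Hausdorff_space X"
    using assms(1) by (simp add: closed_orientable_surface_def closed_surface_def)
  have cls_eq: "?cls \<phi> = ?cls \<phi>'" if "\<phi>' \<in> loop_class ?C ?b \<phi>" for \<phi> \<phi>'
    using homologous_lift_chain [OF X x] that by (simp add: loop_class_def homologous_rel_set_eq)
  have \<omega>: "braid_homology n X x (loop_class ?C ?b \<phi>) = ?cls \<phi>" if \<phi>: "\<phi> \<in> loops_at ?C ?b" for \<phi>
  proof -
    \<comment> \<open>The image is a singleton, which is exactly what gives \<open>the_elem\<close>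
      in \<open>braid_homology\<close> its intended value.\<close>
    have "?cls ` loop_class ?C ?b \<phi> = {?cls \<phi>}"
      using cls_eq loop_class_self [OF \<phi>] by blast
    then show ?thesis by (simp add: braid_homology_def)
  qed
  have "group_hom (surface_braid_group n X x) (homology_group 1 X) (braid_homology n X x)"
    unfolding surface_braid_group_def
  proof (intro group_hom.intro group_hom_axioms.intro homI)
    show "group (fundamental_group ?C ?b)"
      by (intro group_fundamental_group config_class_in_unordered_config x)
    show "group (homology_group 1 X)" by simp
    fix a assume "a \<in> carrier (fundamental_group ?C ?b)"
    then obtain \<phi> where \<phi>: "\<phi> \<in> loops_at ?C ?b" "a = loop_class ?C ?b \<phi>"
      by (auto simp: fundamental_group_def)
    show "braid_homology n X x a \<in> carrier (homology_group 1 X)"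
      using singular_relcycle_lift_chain [OF X x \<phi>(1)] carrier_relative_homology_group [of 1 X "{}"]
      by (auto simp: \<phi> \<omega>)
    fix b assume "b \<in> carrier (fundamental_group ?C ?b)"
    then obtain \<phi>' where \<phi>': "\<phi>' \<in> loops_at ?C ?b" "b = loop_class ?C ?b \<phi>'"
      by (auto simp: fundamental_group_def)
    have "?cls (path_concat \<phi> \<phi>') = homologous_rel_set 1 X {} (lift_chain n X x \<phi> + lift_chain n X x \<phi>')"
      unfolding homologous_rel_set_eq by (rule homologous_lift_chain_concat [OF X x \<phi>(1) \<phi>'(1)])
    also have "\<dots> = ?cls \<phi> \<otimes>\<^bsub>homology_group 1 X\<^esub> ?cls \<phi>'"
      using mult_homologous_rel_set [of 1 X "{}"] by simp
    finally show "braid_homology n X x (a \<otimes>\<^bsub>fundamental_group ?C ?b\<^esub> b) =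
        braid_homology n X x a \<otimes>\<^bsub>homology_group 1 X\<^esub> braid_homology n X x b"
      by (simp add: \<phi> \<phi>' mult_fundamental_group \<omega> path_concat_in_loops_at)
  qed
  moreover have "?cls \<phi> = ?cls \<phi>'"
    if "\<phi>' \<in> loops_at ?C ?b" "loop_class ?C ?b \<phi> = loop_class ?C ?b \<phi>'" for \<phi> \<phi>'
    using cls_eq [of \<phi>' \<phi>] loop_class_self [OF that(1)] that(2) by simp
  ultimately show ?thesis
    using ex1_config_lift [OF X x] singular_relcycle_lift_chain [OF X x] \<omega>
    by (intro conjI ballI impI)
qed

end
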